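(* Let $(G,N,\theta)$ be a character triple, and let $\pi$ be a set of primes. Then the following are equivalent. (a) The order of $[\theta]_{G/N}\in H^2(G/N,\mathbb{C}^\times)$ is a $\pi$-number. (b) For each prime $p\notin\pi$, $\theta$ extends to $P$ for some $P/N\in\mathrm{Syl}_p(G/N)$. (c) There exists a complex-valued class function $\tilde\theta$ of $G$ such that for each $\pi'$-subgroup $H/N$ of $G/N$, the restriction $\tilde\theta_H$ of $\tilde\theta$ to $H$ is an extension (as a character) of $\theta$ to $H$; that is, $\tilde\theta_H$ is a character of $H$ whose restriction to $N$ is $\theta$.
   Context: All groups are finite. A character triple $(G,N,\theta)$ consists of a finite group $G$, a normal subgroup $N$ of $G$ and a $G$-invariant irreducible complex character $\theta\in\mathrm{Irr}(N)$. The cohomology element $[\theta]_{G/N}$: there exists a complex projective representation $\mathfrak{X}$ of $G$ such that $\mathfrak{X}_N$ is an ordinary representation of $N$ affording $\theta$, and $\mathfrak{X}(ag)=\mathfrak{X}(a)\mathfrak{X}(g)$, $\mathfrak{X}(ga)=\mathfrak{X}(g)\mathfrak{X}(a)$ for all $g\in G$, $a\in N$. Its factor set $\alpha\in Z^2(G,\mathbb{C}^\times)$, given by $\mathfrak{X}(x)\mathfrak{X}(y)=\alpha(x,y)\mathfrak{X}(xy)$, is inflated from some $\bar\alpha\in Z^2(G/N,\mathbb{C}^\times)$ (trivial action on $\mathbb{C}^\times$), and $[\theta]_{G/N}:=[\bar\alpha]\in H^2(G/N,\mathbb{C}^\times)$ depends only on $\theta$. A $\pi$-number is a positive integer all of whose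 prime divisors lie in $\pi$; $\pi'$ denotes the complement of $\pi$ in the set of all primes, and a $\pi'$-group is a group whose order is a $\pi'$-number. For $N\le H\le G$, "$\theta$ extends to $H$" means there is a character of $H$ whose restriction to $N$ is $\theta$. *)

theory Defs
  imports
    "HOL-Algebra.Multiplicative_Group"
    "HOL-Computational_Algebra.Primes"
    "Jordan_Normal_Form.VS_Connect"
begin

section \<open>Complex representations and characters\<close>

definition GL :: "nat \<Rightarrow> complex mat monoid" where
  "GL n = units_of (ring_mat TYPE(complex) n ())"

definition mat_trace :: "complex mat \<Rightarrow> complex" where
  "mat_trace A = (\<Sum>i<dim_row A. A $$ (i, i))"

definition representation ::
  "('a, 'b) monoid_scheme \<Rightarrow> nat \<Rightarrow> ('a \<Rightarrow> complex mat) \<Rightarrow> bool" where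
  "representation G n X \<longleftrightarrow> n > 0 \<and> X \<in> hom G (GL n)"

text \<open>Functions on a group are total on the ambient type; only their values on the carrier
  are ever constrained or used, so restricting a character to a subgroup \<open>H\<close> means
  regarding the same function over \<open>G\<lparr>carrier := H\<rparr>\<close>.\<close>

definition affords ::
  "('a, 'b) monoid_scheme \<Rightarrow> ('a \<Rightarrow> complex mat) \<Rightarrow> ('a \<Rightarrow> complex) \<Rightarrow> bool" where
  "affords G X \<chi> \<longleftrightarrow> (\<forall>g\<in>carrier G. \<chi> g = mat_trace (X g))"

definition irreducible_representation ::
  "('a, 'b) monoid_scheme \<Rightarrow> nat \<Rightarrow> ('a \<Rightarrow> complex mat) \<Rightarrow> bool" where
  "irreducible_representation G n X \<longleftrightarrow> representation G n X \<and>
     (\<forall>W. VectorSpace.subspace class_ring W (module_vec TYPE(complex) n) \<and>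
          (\<forall>g\<in>carrier G. \<forall>w\<in>W. X g *\<^sub>v w \<in> W) \<longrightarrow>
          W = {0\<^sub>v n} \<or> W = carrier_vec n)"

definition is_character :: "('a, 'b) monoid_scheme \<Rightarrow> ('a \<Rightarrow> complex) \<Rightarrow> bool" where
  "is_character G \<chi> \<longleftrightarrow> (\<exists>n X. representation G n X \<and> affords G X \<chi>)"

definition irreducible_character :: "('a, 'b) monoid_scheme \<Rightarrow> ('a \<Rightarrow> complex) \<Rightarrow> bool" where
  "irreducible_character G \<chi> \<longleftrightarrow> (\<exists>n X. irreducible_representation G n X \<and> affords G X \<chi>)"

definition class_function :: "('a, 'b) monoid_scheme \<Rightarrow> ('a \<Rightarrow> complex) \<Rightarrow> bool" where
  "class_function G \<phi> \<longleftrightarrow>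
     (\<forall>g\<in>carrier G. \<forall>x\<in>carrier G. \<phi> (g \<otimes>\<^bsub>G\<^esub> x \<otimes>\<^bsub>G\<^esub> inv\<^bsub>G\<^esub> g) = \<phi> x)"

definition is_extension ::
  "('a, 'b) monoid_scheme \<Rightarrow> 'a set \<Rightarrow> ('a \<Rightarrow> complex) \<Rightarrow> 'a set \<Rightarrow> ('a \<Rightarrow> complex) \<Rightarrow> bool" where
  "is_extension G N \<theta> H \<chi> \<longleftrightarrow> is_character (G\<lparr>carrier := H\<rparr>) \<chi> \<and> (\<forall>a\<in>N. \<chi> a = \<theta> a)"

definition extends_to ::
  "('a, 'b) monoid_scheme \<Rightarrow> 'a set \<Rightarrow> ('a \<Rightarrow> complex) \<Rightarrow> 'a set \<Rightarrow> bool" where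
  "extends_to G N \<theta> H \<longleftrightarrow> (\<exists>\<chi>. is_extension G N \<theta> H \<chi>)"

locale character_triple = normal N G
  for G :: "('a, 'b) monoid_scheme" (structure) and N :: "'a set" +
  fixes \<theta> :: "'a \<Rightarrow> complex"
  assumes finite_carrier: "finite (carrier G)"
    and irreducible: "irreducible_character (G\<lparr>carrier := N\<rparr>) \<theta>"
    and invariant: "\<lbrakk>g \<in> carrier G; a \<in> N\<rbrakk> \<Longrightarrow> \<theta> (g \<otimes> a \<otimes> inv g) = \<theta> a"


section \<open>The second cohomology group with trivial action on the nonzero complex numbers\<close>

text \<open>Cochains are extensional functions, so that equality of cochains is equality on the group.\<close>

definition Z2 :: "('a, 'b) monoid_scheme \<Rightarrow> ('a \<times> 'a \<Rightarrow> complex) monoid" where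
  "Z2 Q = \<lparr>carrier =
       {\<alpha> \<in> carrier Q \<times> carrier Q \<rightarrow>\<^sub>E - {0}.
          \<forall>x\<in>carrier Q. \<forall>y\<in>carrier Q. \<forall>z\<in>carrier Q.
            \<alpha> (x, y) * \<alpha> (x \<otimes>\<^bsub>Q\<^esub> y, z) = \<alpha> (x, y \<otimes>\<^bsub>Q\<^esub> z) * \<alpha> (y, z)},
     mult = (\<lambda>\<alpha> \<beta>. \<lambda>t\<in>carrier Q \<times> carrier Q. \<alpha> t * \<beta> t),
     one = (\<lambda>t\<in>carrier Q \<times> carrier Q. 1)\<rparr>"

definition coboundary :: "('a, 'b) monoid_scheme \<Rightarrow> ('a \<Rightarrow> complex) \<Rightarrow> 'a \<times> 'a \<Rightarrow> complex" where
  "coboundary Q \<mu> = (\<lambda>(x, y)\<in>carrier Q \<times> carrier Q. \<mu> x * \<mu> y / \<mu> (x \<otimes>\<^bsub>Q\<^esub> y))"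

definition B2 :: "('a, 'b) monoid_scheme \<Rightarrow> ('a \<times> 'a \<Rightarrow> complex) set" where
  "B2 Q = coboundary Q ` (carrier Q \<rightarrow> - {0})"

definition H2 :: "('a, 'b) monoid_scheme \<Rightarrow> ('a \<times> 'a \<Rightarrow> complex) set monoid" where
  "H2 Q = Z2 Q Mod B2 Q"

definition cohomology_class ::
  "('a, 'b) monoid_scheme \<Rightarrow> ('a \<times> 'a \<Rightarrow> complex) \<Rightarrow> ('a \<times> 'a \<Rightarrow> complex) set" where
  "cohomology_class Q \<alpha> = B2 Q #>\<^bsub>Z2 Q\<^esub> \<alpha>"

lemma Z2_memD:
  assumes "\<alpha> \<in> carrier (Z2 Q)" "x \<in> carrier Q" "y \<in> carrier Q"
  shows "\<alpha> (x, y) \<noteq> 0"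
  using assms by (auto simp: Z2_def PiE_iff)

lemma (in group) comm_group_Z2: "comm_group (Z2 G)"
proof (rule comm_groupI)
  fix \<alpha> \<beta> \<gamma>
  assume \<alpha>: "\<alpha> \<in> carrier (Z2 G)" and \<beta>: "\<beta> \<in> carrier (Z2 G)"
  show "\<alpha> \<otimes>\<^bsub>Z2 G\<^esub> \<beta> \<in> carrier (Z2 G)"
  proof -
    have "\<alpha> (x, y) * \<beta> (x, y) * (\<alpha> (x \<otimes> y, z) * \<beta> (x \<otimes> y, z)) =
        \<alpha> (x, y \<otimes> z) * \<beta> (x, y \<otimes> z) * (\<alpha> (y, z) * \<beta> (y, z))"
      if "x \<in> carrier G" "y \<in> carrier G" "z \<in> carrier G" for x y z
    proof -
      have "\<alpha> (x, y) * \<alpha> (x \<otimes> y, z) * (\<beta> (x, y) * \<beta> (x \<otimes> y, z)) =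
          \<alpha> (x, y \<otimes> z) * \<alpha> (y, z) * (\<beta> (x, y \<otimes> z) * \<beta> (y, z))"
        using \<alpha> \<beta> that by (auto simp: Z2_def)
      then show ?thesis by (simp only: ac_simps)
    qed
    then show ?thesis using \<alpha> \<beta> by (auto simp: Z2_def PiE_iff)
  qed
  show "\<alpha> \<otimes>\<^bsub>Z2 G\<^esub> \<beta> = \<beta> \<otimes>\<^bsub>Z2 G\<^esub> \<alpha>"
    by (auto simp: Z2_def restrict_def fun_eq_iff)
  show "\<alpha> \<otimes>\<^bsub>Z2 G\<^esub> \<beta> \<otimes>\<^bsub>Z2 G\<^esub> \<gamma> = \<alpha> \<otimes>\<^bsub>Z2 G\<^esub> (\<beta> \<otimes>\<^bsub>Z2 G\<^esub> \<gamma>)"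
    by (auto simp: Z2_def restrict_def fun_eq_iff)
  show "\<one>\<^bsub>Z2 G\<^esub> \<otimes>\<^bsub>Z2 G\<^esub> \<alpha> = \<alpha>"
    using \<alpha> by (auto simp: Z2_def restrict_def fun_eq_iff PiE_iff extensional_def)
  have "(\<lambda>t\<in>carrier G \<times> carrier G. inverse (\<alpha> t)) \<in> carrier (Z2 G)"
    using \<alpha> by (auto simp: Z2_def PiE_iff inverse_mult_distrib[symmetric] simp del: inverse_mult_distrib)
  moreover have "(\<lambda>t\<in>carrier G \<times> carrier G. inverse (\<alpha> t)) \<otimes>\<^bsub>Z2 G\<^esub> \<alpha> = \<one>\<^bsub>Z2 G\<^esub>"
    using Z2_memD[OF \<alpha>] by (auto simp: Z2_def restrict_def fun_eq_iff)
  ultimately show "\<exists>\<beta>\<in>carrier (Z2 G). \<beta> \<otimes>\<^bsub>Z2 G\<^esub> \<alpha> = \<one>\<^bsub>Z2 G\<^esub>" by blast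
next
  show "\<one>\<^bsub>Z2 G\<^esub> \<in> carrier (Z2 G)" by (auto simp: Z2_def)
qed

lemma (in group) coboundary_in_Z2:
  assumes "\<mu> \<in> carrier G \<rightarrow> - {0}"
  shows "coboundary G \<mu> \<in> carrier (Z2 G)"
  using assms by (auto simp: Z2_def coboundary_def PiE_iff Pi_iff m_assoc)

lemma (in group) B2_normal: "B2 G \<lhd> Z2 G"
proof -
  interpret Z: comm_group "Z2 G" by (rule comm_group_Z2)
  have mult: "coboundary G \<mu> \<otimes>\<^bsub>Z2 G\<^esub> coboundary G \<nu> = coboundary G (\<lambda>x. \<mu> x * \<nu> x)" for \<mu> \<nu>
    by (auto simp: Z2_def coboundary_def restrict_def fun_eq_iff)
  have one: "coboundary G (\<lambda>x. 1) = \<one>\<^bsub>Z2 G\<^esub>"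
    by (auto simp: Z2_def coboundary_def restrict_def fun_eq_iff)
  have "subgroup (B2 G) (Z2 G)"
  proof (rule Z.subgroupI)
    show "B2 G \<subseteq> carrier (Z2 G)" using coboundary_in_Z2 by (auto simp: B2_def)
    have "coboundary G (\<lambda>x. 1) \<in> B2 G" by (auto simp: B2_def)
    then show "B2 G \<noteq> {}" by blast
  next
    fix \<alpha> assume "\<alpha> \<in> B2 G"
    then obtain \<mu> where \<mu>: "\<mu> \<in> carrier G \<rightarrow> - {0}" "\<alpha> = coboundary G \<mu>" by (auto simp: B2_def)
    have "coboundary G (\<lambda>x. inverse (\<mu> x)) \<otimes>\<^bsub>Z2 G\<^esub> \<alpha> = \<one>\<^bsub>Z2 G\<^esub>"
      unfolding \<mu>(2) mult one[symmetric] using \<mu>(1)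
      by (auto simp: coboundary_def restrict_def fun_eq_iff Pi_iff)
    moreover have "coboundary G (\<lambda>x. inverse (\<mu> x)) \<in> B2 G"
      using \<mu>(1) by (auto simp: B2_def Pi_iff)
    moreover have "\<alpha> \<in> carrier (Z2 G)" using \<mu> coboundary_in_Z2 by simp
    moreover have "coboundary G (\<lambda>x. inverse (\<mu> x)) \<in> carrier (Z2 G)"
      using \<mu>(1) by (intro coboundary_in_Z2) (auto simp: Pi_iff)
    ultimately show "inv\<^bsub>Z2 G\<^esub> \<alpha> \<in> B2 G" by (simp add: Z.inv_equality)
  next
    fix \<alpha> \<beta> assume "\<alpha> \<in> B2 G" "\<beta> \<in> B2 G"
    then obtain \<mu> \<nu> where "\<mu> \<in> carrier G \<rightarrow> - {0}" "\<nu> \<in> carrier G \<rightarrow> - {0}"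
      and eq: "\<alpha> = coboundary G \<mu>" "\<beta> = coboundary G \<nu>"
      by (auto simp: B2_def)
    then have "(\<lambda>x. \<mu> x * \<nu> x) \<in> carrier G \<rightarrow> - {0}" by (auto simp: Pi_iff)
    then show "\<alpha> \<otimes>\<^bsub>Z2 G\<^esub> \<beta> \<in> B2 G" unfolding eq mult by (auto simp: B2_def)
  qed
  then show ?thesis by (simp add: Z.normal_iff_subgroup)
qed

lemma (in group) group_H2: "group (H2 G)"
  unfolding H2_def using B2_normal by (rule normal.factorgroup_is_group)


section \<open>The cohomology element of a character triple\<close>

definition projective_representation ::
  "('a, 'b) monoid_scheme \<Rightarrow> nat \<Rightarrow> ('a \<times> 'a \<Rightarrow> complex) \<Rightarrow> ('a \<Rightarrow> complex mat) \<Rightarrow> bool" where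
  "projective_representation G n \<alpha> X \<longleftrightarrow>
     n > 0 \<and> X \<in> carrier G \<rightarrow> carrier (GL n) \<and> \<alpha> \<in> carrier (Z2 G) \<and>
     (\<forall>x\<in>carrier G. \<forall>y\<in>carrier G. X x * X y = \<alpha> (x, y) \<cdot>\<^sub>m X (x \<otimes>\<^bsub>G\<^esub> y))"

definition associated_projective_representation ::
  "('a, 'b) monoid_scheme \<Rightarrow> 'a set \<Rightarrow> ('a \<Rightarrow> complex) \<Rightarrow> nat \<Rightarrow> ('a \<times> 'a \<Rightarrow> complex) \<Rightarrow>
     ('a \<Rightarrow> complex mat) \<Rightarrow> bool" where
  "associated_projective_representation G N \<theta> n \<alpha> X \<longleftrightarrow>
     projective_representation G n \<alpha> X \<and>
     representation (G\<lparr>carrier := N\<rparr>) n X \<and> affords (G\<lparr>carrier := N\<rparr>) X \<theta> \<and>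
     (\<forall>g\<in>carrier G. \<forall>a\<in>N. X (a \<otimes>\<^bsub>G\<^esub> g) = X a * X g \<and> X (g \<otimes>\<^bsub>G\<^esub> a) = X g * X a)"

definition inflation ::
  "('a, 'b) monoid_scheme \<Rightarrow> 'a set \<Rightarrow> ('a set \<times> 'a set \<Rightarrow> complex) \<Rightarrow> 'a \<times> 'a \<Rightarrow> complex" where
  "inflation G N \<beta> = (\<lambda>(x, y)\<in>carrier G \<times> carrier G. \<beta> (N #>\<^bsub>G\<^esub> x, N #>\<^bsub>G\<^esub> y))"

text \<open>For a character triple the class described below exists and depends only on \<open>\<theta>\<close>,
  not on the choice of \<open>X\<close>.\<close>

definition cohomology_element ::
  "('a, 'b) monoid_scheme \<Rightarrow> 'a set \<Rightarrow> ('a \<Rightarrow> complex) \<Rightarrow> ('a set \<times> 'a set \<Rightarrow> complex) set" where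
  "cohomology_element G N \<theta> =
     (THE c. \<exists>n X \<alpha> \<beta>. associated_projective_representation G N \<theta> n \<alpha> X \<and>
        \<beta> \<in> carrier (Z2 (G Mod N)) \<and> \<alpha> = inflation G N \<beta> \<and>
        c = cohomology_class (G Mod N) \<beta>)"


section \<open>Sets of primes and Sylow subgroups\<close>

definition pi_number :: "nat set \<Rightarrow> nat \<Rightarrow> bool" where
  "pi_number \<pi> n \<longleftrightarrow> n > 0 \<and> (\<forall>p. Factorial_Ring.prime p \<and> p dvd n \<longrightarrow> p \<in> \<pi>)"

definition prime_complement :: "nat set \<Rightarrow> nat set" where
  "prime_complement \<pi> = {p. Factorial_Ring.prime p} - \<pi>"

definition pi_group :: "nat set \<Rightarrow> ('a, 'b) monoid_scheme \<Rightarrow> bool" where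
  "pi_group \<pi> G \<longleftrightarrow> group G \<and> pi_number \<pi> (Coset.order G)"

definition Syl :: "nat \<Rightarrow> ('a, 'b) monoid_scheme \<Rightarrow> 'a set set" where
  "Syl p G = {S. subgroup S G \<and> card S = p ^ Factorial_Ring.multiplicity p (Coset.order G)}"

end

theory Submission
  imports
    Defs
    "HOL-Algebra.Sylow"
    "Jordan_Normal_Form.Spectral_Radius"
begin

text \<open>Let \<open>X\<close> be the projective representation of \<open>G\<close> attached to \<open>\<theta>\<close>, with factor set \<open>\<beta>\<close> on \<open>G/N\<close>.
  By Schur's lemma \<open>\<theta>\<close> extends to \<open>H\<close> iff \<open>\<beta>\<close> splits on \<open>H/N\<close>, and a transfer argument shows that
  if \<open>\<beta>\<close> splits on a subgroup \<open>S\<close>, then \<open>\<beta>\<^bsup>|G/N : S|\<^esup>\<close> splits; applied to Sylow subgroups, this is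
  (b) \<open>\<Longrightarrow>\<close> (a).  For (a) \<open>\<Longrightarrow>\<close> (c), rescale \<open>X\<close> so that \<open>\<beta>\<^sup>m = 1\<close>, where \<open>m\<close> is the order of the
  cohomology class.  If \<open>g\<^sup>r \<in> N\<close> with \<open>r\<close> prime to \<open>m\<close>, there is at most one multiple \<open>W\<close> of \<open>X g\<close> by
  an \<open>m\<close>-th root of unity such that \<open>W\<^sup>r = X (g\<^sup>r)\<close>, and its trace is the value of the class function at
  \<open>g\<close>.  Finally (c) \<open>\<Longrightarrow>\<close> (b) because \<open>p\<close>-groups with \<open>p \<notin> \<pi>\<close> are \<open>\<pi>'\<close>-groups.\<close>

section \<open>Schur's lemma and characters\<close>

text \<open>The obstacle between (a) and (c) is that a splitting of \<beta> on H/N is determined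
  only up to a linear character of H/N, so extensions chosen separately for several H need not agree
  where these subgroups meet. Allowing only m-th roots of unity as values removes the freedom: if
  |H/N| is prime to m, a linear character of H/N whose values are m-th roots of unity is trivial.
  The same restriction yields a class function, since conjugation by a matrix \<open>X x\<close>
  changes scalars only by values of \<beta>. The rescaling that makes \<beta> take such values needs
  m-th roots of the splitting cochain, which exist because the coefficients are the nonzero complex
  numbers. Invariance of \<theta> is an equation between traces, whereas \<open>X\<close> requires
  matrices relating conjugate representations of N. These come from averaging over N: if all
  averages vanished, the orthogonality sum would be 0 instead of |N|.\<close>

lemma GL_iff:
  "A \<in> carrier (GL n) \<longleftrightarrow>
     A \<in> carrier_mat n n \<and> (\<exists>B\<in>carrier_mat n n. A * B = 1\<^sub>m n \<and> B * A = 1\<^sub>m n)"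
  by (auto simp: GL_def units_of_def Units_def ring_mat_simps)

lemma GL_mult [simp]: "A \<otimes>\<^bsub>GL n\<^esub> B = A * B"
  by (simp add: GL_def units_of_def ring_mat_simps)

lemma GL_one [simp]: "\<one>\<^bsub>GL n\<^esub> = 1\<^sub>m n"
  by (simp add: GL_def units_of_def ring_mat_simps)

lemma group_GL: "group (GL n)"
proof -
  interpret ring "ring_mat TYPE(complex) n ()" by (rule ring_mat)
  show ?thesis unfolding GL_def by (rule units_group)
qed

lemma GL_carrier_mat: "A \<in> carrier (GL n) \<Longrightarrow> A \<in> carrier_mat n n"
  by (simp add: GL_iff)

text \<open>The passage from matrix identities to identities between factor sets. After
  multiplication by the inverse, the entry at (0,0) decides, and it exists because
  \<open>n > 0\<close>.\<close>

lemma GL_smult_cancel: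
  assumes "A \<in> carrier (GL n)" "n > 0" "c \<cdot>\<^sub>m A = d \<cdot>\<^sub>m A"
  shows "c = d"
proof -
  obtain B where B: "B \<in> carrier_mat n n" "A * B = 1\<^sub>m n" and A: "A \<in> carrier_mat n n"
    using assms(1) by (auto simp: GL_iff)
  have "c \<cdot>\<^sub>m A * B = d \<cdot>\<^sub>m A * B" using assms(3) by simp
  then have "c \<cdot>\<^sub>m 1\<^sub>m n = d \<cdot>\<^sub>m (1\<^sub>m n :: complex mat)"
    using A B by (simp add: mult_smult_assoc_mat[OF A B(1)])
  then have "(c \<cdot>\<^sub>m 1\<^sub>m n) $$ (0,0) = (d \<cdot>\<^sub>m (1\<^sub>m n :: complex mat)) $$ (0,0)" by simp
  then show ?thesis using assms(2) by simp
qed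

lemma smult_smult_mat: "a \<cdot>\<^sub>m (b \<cdot>\<^sub>m A) = (a * b :: 'a :: semigroup_mult) \<cdot>\<^sub>m A"
  by (intro eq_matI) (auto simp: mult.assoc)

lemma one_smult_mat: "(1 :: 'a :: monoid_mult) \<cdot>\<^sub>m A = A"
  by (intro eq_matI) auto

lemma GL_smult:
  assumes "A \<in> carrier (GL n)" "c \<noteq> 0"
  shows "c \<cdot>\<^sub>m A \<in> carrier (GL n)"
proof -
  obtain B where B: "B \<in> carrier_mat n n" "A * B = 1\<^sub>m n" "B * A = 1\<^sub>m n" and A: "A \<in> carrier_mat n n"
    using assms(1) by (auto simp: GL_iff)
  have "c \<cdot>\<^sub>m A * (inverse c \<cdot>\<^sub>m B) = 1\<^sub>m n" "inverse c \<cdot>\<^sub>m B * (c \<cdot>\<^sub>m A) = 1\<^sub>m n"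
    using A B assms(2)
    by (simp_all add: mult_smult_assoc_mat[of A n n _ n] mult_smult_distrib[of A n n B n]
        mult_smult_assoc_mat[of B n n _ n] mult_smult_distrib[of B n n A n] smult_smult_mat one_smult_mat)
  moreover have "inverse c \<cdot>\<^sub>m B \<in> carrier_mat n n" "c \<cdot>\<^sub>m A \<in> carrier_mat n n" using A B(1) by simp_all
  ultimately show ?thesis unfolding GL_iff by blast
qed

lemma mult_mat_entry:
  assumes "A \<in> carrier_mat m n" "B \<in> carrier_mat n p" "i < m" "l < p"
  shows "(A * B) $$ (i, l) = (\<Sum>k<n. A $$ (i, k) * B $$ (k, l))"
  using assms by (auto simp: scalar_prod_def atLeast0LessThan)

lemma mat_trace_comm:
  assumes "A \<in> carrier_mat n n" "B \<in> carrier_mat n n"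
  shows "mat_trace (A * B) = mat_trace (B * A)"
proof -
  have *: "mat_trace (C * D) = (\<Sum>i<n. \<Sum>k<n. C $$ (i,k) * D $$ (k,i))"
    if "C \<in> carrier_mat n n" "D \<in> carrier_mat n n" for C D
    using that by (auto simp: mat_trace_def scalar_prod_def atLeast0LessThan intro!: sum.cong)
  have "mat_trace (A * B) = (\<Sum>k<n. \<Sum>i<n. A $$ (i,k) * B $$ (k,i))"
    using assms by (subst *) (auto intro: sum.swap)
  also have "\<dots> = mat_trace (B * A)"
    using assms by (subst *) (auto simp: mult.commute)
  finally show ?thesis .
qed

lemma mat_trace_conj:
  assumes "A \<in> carrier_mat n n" "B \<in> carrier_mat n n" "C \<in> carrier_mat n n" "C * A = 1\<^sub>m n"
  shows "mat_trace (A * B * C) = mat_trace B"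
proof -
  have "mat_trace (A * B * C) = mat_trace (C * (A * B))"
    using assms by (intro mat_trace_comm[of _ n]) auto
  also have "C * (A * B) = B"
    using assms by (simp flip: assoc_mult_mat[of _ n n _ n _ n])
  finally show ?thesis .
qed

lemma mat_trace_one: "mat_trace (1\<^sub>m n) = of_nat n"
  by (simp add: mat_trace_def)

lemma mat_trace_smult: "A \<in> carrier_mat n n \<Longrightarrow> mat_trace (c \<cdot>\<^sub>m A) = c * mat_trace A"
  by (auto simp: mat_trace_def sum_distrib_left)

section \<open>Invariant kernels and the two forms of Schur's lemma\<close>

lemma kernel_subspace:
  assumes "A \<in> carrier_mat n n"
  shows "VectorSpace.subspace class_ring {v \<in> carrier_vec n. A *\<^sub>v v = 0\<^sub>v n}
    (module_vec TYPE(complex) n)"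
  unfolding VectorSpace.subspace_def submodule_def
  using assms
  by (auto simp: vec_vs vec_module module_vec_simps class_ring_simps mult_add_distrib_mat_vec mult_mat_vec)

lemma mult_mat_unit_vec:
  fixes A :: "'a :: semiring_1 mat"
  assumes "A \<in> carrier_mat m n" "j < n"
  shows "A *\<^sub>v unit_vec n j = col A j"
  using assms by (intro eq_vecI) auto

lemma smult_mat_mult_vec:
  fixes A :: "'a :: comm_semiring_1 mat"
  assumes "A \<in> carrier_mat m n" "v \<in> carrier_vec n"
  shows "(c \<cdot>\<^sub>m A) *\<^sub>v v = c \<cdot>\<^sub>v (A *\<^sub>v v)"
  using assms by (intro eq_vecI) (auto simp: scalar_prod_def sum_distrib_left mult.assoc)

text \<open>If \<open>T\<close> kills \<open>v\<close>, then it kills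
  \<open>Y g *\<^sub>v v\<close>, because this vector is sent to \<open>X g\<close> applied to 0. So
  the kernel is invariant under \<open>Y\<close>, and it is not everything as \<open>T\<close> is
  nonzero. Since \<open>T\<close> is square, a trivial kernel makes it invertible, and
  irreducibility is asked of \<open>Y\<close> only.\<close>

lemma schur_invertible:
  assumes Y: "irreducible_representation G n Y" and T: "T \<in> carrier_mat n n" "T \<noteq> 0\<^sub>m n n"
    and X: "\<And>g. g \<in> carrier G \<Longrightarrow> X g \<in> carrier_mat n n"
    and intertwines: "\<And>g. g \<in> carrier G \<Longrightarrow> X g * T = T * Y g"
  shows "T \<in> carrier (GL n)"
proof -
  let ?W = "{v \<in> carrier_vec n. T *\<^sub>v v = 0\<^sub>v n}"
  have Yc: "Y g \<in> carrier_mat n n" if "g \<in> carrier G" for g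
    using Y that by (auto simp: irreducible_representation_def representation_def hom_def Pi_iff GL_iff)
  have inv: "Y g *\<^sub>v w \<in> ?W" if g: "g \<in> carrier G" and w: "w \<in> ?W" for g w
  proof -
    have "T *\<^sub>v (Y g *\<^sub>v w) = (X g * T) *\<^sub>v w"
      using g w T Yc[OF g] intertwines[OF g] by simp
    also have "\<dots> = 0\<^sub>v n" using w T X[OF g] by (auto intro!: eq_vecI)
    finally show ?thesis using w Yc[OF g] by auto
  qed
  then have "?W = {0\<^sub>v n} \<or> ?W = carrier_vec n"
    using Y kernel_subspace[OF T(1)] unfolding irreducible_representation_def by blast
  moreover have "?W \<noteq> carrier_vec n"
  proof
    assume "?W = carrier_vec n"
    then have "T *\<^sub>v unit_vec n j = 0\<^sub>v n" if "j < n" for j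
      using unit_vec_carrier[of n j] by blast
    then have "col T j = 0\<^sub>v n" if "j < n" for j
      using that mult_mat_unit_vec[OF T(1)] by simp
    then have "T $$ (i,j) = 0" if "i < n" "j < n" for i j
      using that T(1) by (metis carrier_matD index_col index_zero_vec(1))
    then have "T = 0\<^sub>m n n" using T(1) by (intro eq_matI) auto
    then show False using T(2) by contradiction
  qed
  ultimately have "?W = {0\<^sub>v n}" by blast
  then have "det T \<noteq> 0" using det_0_iff_vec_prod_zero[OF T(1)] by blast
  then show ?thesis
    using det_non_zero_imp_unit[OF T(1)] by (simp add: GL_def units_of_def)
qed

text \<open>Over the complex numbers \<open>M\<close> has an eigenvalue c. Then
  \<open>M - c \<cdot>\<^sub>m 1\<^sub>m n\<close> commutes with \<open>Y\<close> and is singular,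
  so the invertibility form of Schur's lemma forces it to vanish.\<close>

lemma schur_scalar:
  assumes Y: "irreducible_representation G n Y" and M: "M \<in> carrier_mat n n"
    and comm: "\<And>g. g \<in> carrier G \<Longrightarrow> Y g * M = M * Y g"
  shows "\<exists>c. M = c \<cdot>\<^sub>m 1\<^sub>m n"
proof -
  have n: "n > 0" using Y by (simp add: irreducible_representation_def representation_def)
  then obtain c where "eigenvalue M c"
    using spectrum_non_empty[OF M n] by (auto simp: spectrum_def)
  then obtain v where v: "v \<in> carrier_vec n" "v \<noteq> 0\<^sub>v n" "M *\<^sub>v v = c \<cdot>\<^sub>v v"
    using M by (auto simp: eigenvalue_def eigenvector_def)
  let ?T = "M - c \<cdot>\<^sub>m 1\<^sub>m n"
  have T: "?T \<in> carrier_mat n n" by auto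
  have Yc: "Y g \<in> carrier_mat n n" if "g \<in> carrier G" for g
    using Y that by (auto simp: irreducible_representation_def representation_def hom_def Pi_iff GL_iff)
  have "Y g * ?T = ?T * Y g" if g: "g \<in> carrier G" for g
    using M Yc[OF g] comm[OF g]
    by (simp add: mult_minus_distrib_mat[of _ n n] minus_mult_distrib_mat[of _ n n]
        mult_smult_distrib[of _ n n _ n] mult_smult_assoc_mat[of _ n n _ n])
  moreover have "?T \<notin> carrier (GL n)"
  proof
    assume "?T \<in> carrier (GL n)"
    then obtain B where B: "B \<in> carrier_mat n n" "B * ?T = 1\<^sub>m n" by (auto simp: GL_iff)
    have "?T *\<^sub>v v = 0\<^sub>v n"
      using M v(1,3) smult_mat_mult_vec[of "1\<^sub>m n" n n v c]
      by (simp add: minus_mult_distrib_mat_vec[of _ n n])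
    then have "(B * ?T) *\<^sub>v v = 0\<^sub>v n" using B v by (subst assoc_mult_mat_vec[of _ n n _ n]) auto
    then show False using B v by simp
  qed
  ultimately have "?T = 0\<^sub>m n n"
    using schur_invertible[OF Y T] Yc by blast
  then have "?T $$ (i,j) = 0" if "i < n" "j < n" for i j
    using that by simp
  then have "M = c \<cdot>\<^sub>m 1\<^sub>m n"
    using M by (intro eq_matI) auto
  then show ?thesis ..
qed

lemma representation_carrier_mat:
  "representation G n X \<Longrightarrow> g \<in> carrier G \<Longrightarrow> X g \<in> carrier_mat n n"
  by (auto simp: representation_def hom_def Pi_iff GL_iff)

lemma representation_mult:
  "representation G n X \<Longrightarrow> g \<in> carrier G \<Longrightarrow> h \<in> carrier G \<Longrightarrow> X (g \<otimes>\<^bsub>G\<^esub> h) = X g * X h"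
  by (auto simp: representation_def hom_def)

lemma (in group) representation_one:
  "representation G n X \<Longrightarrow> X \<one> = 1\<^sub>m n"
  using hom_one[OF _ is_group group_GL, of X n] by (simp add: representation_def)

lemma irreducible_representation_imp_representation:
  "irreducible_representation G n X \<Longrightarrow> representation G n X"
  by (simp add: irreducible_representation_def)

section \<open>Averages over a finite group and orthogonality of characters\<close>

definition unit_mat :: "nat \<Rightarrow> nat \<Rightarrow> nat \<Rightarrow> complex mat" where
  "unit_mat n j k = mat n n (\<lambda>(i, l). if i = j \<and> l = k then 1 else 0)"

lemma unit_mat_carrier [simp]: "unit_mat n j k \<in> carrier_mat n n"
  by (simp add: unit_mat_def)

context group
begin

text \<open>The sum is taken entry by entry because one type holds matrices of all sizes and so has
  no single zero. There is no factor 1/|G|: only intertwining, vanishing and traces matter.\<close>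

definition average_mat ::
    "nat \<Rightarrow> ('a \<Rightarrow> complex mat) \<Rightarrow> complex mat \<Rightarrow> ('a \<Rightarrow> complex mat) \<Rightarrow> complex mat" where
  "average_mat n X A Y = mat n n (\<lambda>(i, l). \<Sum>a\<in>carrier G. (X a * A * Y (inv a)) $$ (i, l))"

lemma average_mat_carrier [simp]: "average_mat n X A Y \<in> carrier_mat n n"
  by (simp add: average_mat_def)

text \<open>Multiplication by \<open>X b\<close> turns the summand at a into the summand at b
  \<otimes> a followed by \<open>Y b\<close>, and a \<mapsto> b \<otimes> a permutes the
  group.\<close>

lemma average_mat_intertwines:
  assumes X: "representation G n X" and Y: "representation G n Y" and A: "A \<in> carrier_mat n n"
    and b: "b \<in> carrier G"
  shows "X b * average_mat n X A Y = average_mat n X A Y * Y b"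
proof (rule eq_matI)
  note car = representation_carrier_mat[OF X] representation_carrier_mat[OF Y]
  let ?f = "\<lambda>a. X a * A * Y (inv a)"
  have f: "?f a \<in> carrier_mat n n" if "a \<in> carrier G" for a
    using A by (intro mult_carrier_mat[of _ n n] car) (auto simp: that)
  fix i l assume "i < dim_row (average_mat n X A Y * Y b)" "l < dim_col (average_mat n X A Y * Y b)"
  then have il: "i < n" "l < n" using car(2)[OF b] by (auto simp: average_mat_def)
  have "(X b * average_mat n X A Y) $$ (i,l) = (\<Sum>k<n. X b $$ (i,k) * (\<Sum>a\<in>carrier G. ?f a $$ (k,l)))"
    using il car(1)[OF b] by (auto simp: scalar_prod_def average_mat_def atLeast0LessThan intro!: sum.cong)
  also have "\<dots> = (\<Sum>a\<in>carrier G. \<Sum>k<n. X b $$ (i,k) * ?f a $$ (k,l))"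
    by (simp add: sum_distrib_left) (rule sum.swap)
  also have "\<dots> = (\<Sum>a\<in>carrier G. (X b * ?f a) $$ (i,l))"
    using il car(1)[OF b] f by (intro sum.cong refl mult_mat_entry[symmetric])
  also have "\<dots> = (\<Sum>a\<in>carrier G. (?f (b \<otimes> a) * Y b) $$ (i,l))"
  proof (intro sum.cong refl)
    fix a assume a: "a \<in> carrier G"
    have "?f (b \<otimes> a) * Y b = X (b \<otimes> a) * A * (Y (inv (b \<otimes> a)) * Y b)"
      using A by (intro assoc_mult_mat[of _ n n _ n _ n] mult_carrier_mat[of _ n n] car) (auto simp: a b)
    also have "Y (inv (b \<otimes> a)) * Y b = Y (inv a)"
      using a b by (subst representation_mult[OF Y, symmetric]) (auto simp: inv_mult_group m_assoc)
    also have "X (b \<otimes> a) * A * Y (inv a) = X b * ?f a"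
      using a b A car(1)[OF a] car(1)[OF b] car(2)[of "inv a"]
      by (simp add: representation_mult[OF X] assoc_mult_mat[of _ n n _ n _ n])
    finally show "(X b * ?f a) $$ (i,l) = (?f (b \<otimes> a) * Y b) $$ (i,l)" by simp
  qed
  also have "\<dots> = (\<Sum>a\<in>carrier G. (?f a * Y b) $$ (i,l))"
    by (rule sum.reindex_bij_betw[where g="\<lambda>a. (?f a * Y b) $$ (i,l)"])
       (rule bij_betw_byWitness[where f'="\<lambda>a. inv b \<otimes> a"], auto simp: b m_assoc[symmetric])
  also have "\<dots> = (\<Sum>a\<in>carrier G. \<Sum>k<n. ?f a $$ (i,k) * Y b $$ (k,l))"
    using il car(2)[OF b] f by (intro sum.cong refl mult_mat_entry)
  also have "\<dots> = (\<Sum>k<n. (\<Sum>a\<in>carrier G. ?f a $$ (i,k)) * Y b $$ (k,l))"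
    by (simp add: sum_distrib_right) (rule sum.swap)
  also have "\<dots> = (average_mat n X A Y * Y b) $$ (i,l)"
    using il car(2)[OF b] by (auto simp: scalar_prod_def average_mat_def atLeast0LessThan intro!: sum.cong)
  finally show "(X b * average_mat n X A Y) $$ (i,l) = (average_mat n X A Y * Y b) $$ (i,l)" .
qed (use representation_carrier_mat[OF X b] representation_carrier_mat[OF Y b] in \<open>auto simp: average_mat_def\<close>)

text \<open>Sandwiching the elementary matrix with its 1 at (i, k) leaves, at the entry (i, k), the
  product of the i-th diagonal entry of \<open>X a\<close> and the k-th diagonal entry of
  \<open>Y (inv a)\<close>. Summing over i and k yields the product of the traces.\<close>

lemma sum_char_mult_eq_average:
  assumes X: "representation G n X" and Y: "representation G n Y"
  shows "(\<Sum>a\<in>carrier G. mat_trace (X a) * mat_trace (Y (inv a))) =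
    (\<Sum>i<n. \<Sum>k<n. average_mat n X (unit_mat n i k) Y $$ (i, k))"
proof -
  note car = representation_carrier_mat[OF X] representation_carrier_mat[OF Y]
  have entry: "(X a * unit_mat n i k * Y (inv a)) $$ (i, k) = X a $$ (i,i) * Y (inv a) $$ (k,k)"
    if a: "a \<in> carrier G" and ik: "i < n" "k < n" for a i k
  proof -
    have "(X a * unit_mat n i k) $$ (i, l) = (if l = k then X a $$ (i,i) else 0)" if "l < n" for l
    proof -
      have "(X a * unit_mat n i k) $$ (i, l) = (\<Sum>j<n. if j = i then (if l = k then X a $$ (i,i) else 0) else 0)"
        using that ik car(1)[OF a]
        by (auto simp: scalar_prod_def unit_mat_def atLeast0LessThan simp del: sum.delta sum.delta' intro!: sum.cong)
      then show ?thesis using ik by (simp add: sum.delta)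
    qed
    note * = this
    have "X a * unit_mat n i k \<in> carrier_mat n n" using car(1)[OF a] by auto
    then have "(X a * unit_mat n i k * Y (inv a)) $$ (i, k) =
        (\<Sum>l<n. (X a * unit_mat n i k) $$ (i, l) * Y (inv a) $$ (l, k))"
      using ik car(2)[of "inv a"] a by (intro mult_mat_entry) auto
    also have "\<dots> = (\<Sum>l<n. if l = k then X a $$ (i,i) * Y (inv a) $$ (k, k) else 0)"
      using * by (intro sum.cong) auto
    finally show ?thesis using ik by simp
  qed
  have "(\<Sum>a\<in>carrier G. mat_trace (X a) * mat_trace (Y (inv a))) =
      (\<Sum>a\<in>carrier G. \<Sum>i<n. \<Sum>k<n. X a $$ (i,i) * Y (inv a) $$ (k,k))"
    using car(1)[THEN carrier_matD(1)] car(2)[THEN carrier_matD(1)]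
    by (intro sum.cong refl) (auto simp: mat_trace_def sum_product)
  also have "\<dots> = (\<Sum>i<n. \<Sum>a\<in>carrier G. \<Sum>k<n. X a $$ (i,i) * Y (inv a) $$ (k,k))"
    by (rule sum.swap)
  also have "\<dots> = (\<Sum>i<n. \<Sum>k<n. \<Sum>a\<in>carrier G. X a $$ (i,i) * Y (inv a) $$ (k,k))"
    by (intro sum.cong refl sum.swap)
  also have "\<dots> = (\<Sum>i<n. \<Sum>k<n. average_mat n X (unit_mat n i k) Y $$ (i, k))"
    by (auto simp: average_mat_def entry intro!: sum.cong)
  finally show ?thesis .
qed

text \<open>By Schur's lemma the average of each elementary matrix is a scalar matrix. Its trace is
  n times the scalar, and also |G| times the trace of the elementary matrix, as conjugation
  preserves traces. So only i = k contributes, each time |G|/n.\<close>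

lemma sum_irreducible_char:
  assumes fin: "finite (carrier G)" and Y: "irreducible_representation G n Y"
  shows "(\<Sum>a\<in>carrier G. mat_trace (Y a) * mat_trace (Y (inv a))) = of_nat (Coset.order G)"
proof -
  have rep: "representation G n Y" and n: "n > 0"
    using Y by (auto simp: irreducible_representation_def representation_def)
  note car = representation_carrier_mat[OF rep]
  have entry: "of_nat n * average_mat n Y (unit_mat n i k) Y $$ (i, k) = (if i = k then of_nat (Coset.order G) else 0)"
    if ik: "i < n" "k < n" for i k
  proof -
    obtain c where c: "average_mat n Y (unit_mat n i k) Y = c \<cdot>\<^sub>m 1\<^sub>m n"
      using schur_scalar[OF Y average_mat_carrier average_mat_intertwines[OF rep rep unit_mat_carrier]] by blast
    have "of_nat n * c = mat_trace (average_mat n Y (unit_mat n i k) Y)"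
      unfolding c by (subst mat_trace_smult[of _ n]) (auto simp: mat_trace_one)
    also have "\<dots> = (\<Sum>a\<in>carrier G. mat_trace (Y a * unit_mat n i k * Y (inv a)))"
      using car unfolding average_mat_def mat_trace_def
      by (simp add: sum.swap[of _ _ "{..<n}"]) (auto intro!: sum.cong)
    also have "\<dots> = (\<Sum>a\<in>carrier G. mat_trace (unit_mat n i k))"
    proof (intro sum.cong refl mat_trace_conj[of _ n])
      fix a assume a: "a \<in> carrier G"
      show "Y (inv a) * Y a = 1\<^sub>m n"
        using a by (simp add: representation_mult[OF rep, symmetric] representation_one[OF rep])
    qed (auto intro: car)
    also have "\<dots> = (if i = k then of_nat (Coset.order G) else 0)"
      using ik fin by (auto simp: mat_trace_def unit_mat_def Coset.order_def sum.delta if_distrib cong: if_cong)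
    finally have "of_nat n * c = (if i = k then of_nat (Coset.order G) else 0)" .
    then show ?thesis using ik unfolding c by auto
  qed
  have "of_nat n * (\<Sum>a\<in>carrier G. mat_trace (Y a) * mat_trace (Y (inv a))) =
      (\<Sum>i<n. \<Sum>k<n. of_nat n * average_mat n Y (unit_mat n i k) Y $$ (i, k))"
    by (simp add: sum_char_mult_eq_average[OF rep rep] sum_distrib_left)
  also have "\<dots> = (\<Sum>i<n. \<Sum>k<n. if i = k then of_nat (Coset.order G) else 0)"
    by (intro sum.cong refl entry) auto
  also have "\<dots> = of_nat n * of_nat (Coset.order G)" by simp
  finally show ?thesis using n by simp
qed

text \<open>Equal characters turn the mixed sum of traces into the one for \<open>Y\<close>, which
  is |G| and not 0. Hence some average is a nonzero intertwiner, and it is invertible by Schur's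
  lemma. Complete reducibility of \<open>X\<close> does not enter.\<close>

lemma irreducible_character_similar:
  assumes fin: "finite (carrier G)" and X: "representation G m X" and Y: "irreducible_representation G n Y"
    and char: "\<And>g. g \<in> carrier G \<Longrightarrow> mat_trace (X g) = mat_trace (Y g)"
  shows "m = n \<and> (\<exists>T\<in>carrier (GL n). \<forall>g\<in>carrier G. X g * T = T * Y g)"
proof -
  note rep = irreducible_representation_imp_representation[OF Y]
  have "(of_nat m :: complex) = of_nat n"
    using char[of \<one>] by (simp add: representation_one[OF X] representation_one[OF rep] mat_trace_one)
  then have mn: "m = n" by simp
  note X = X[unfolded mn]
  have "\<exists>A\<in>carrier_mat n n. average_mat n X A Y \<noteq> 0\<^sub>m n n"
  proof (rule ccontr)
    assume "\<not> ?thesis"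
    then have "(\<Sum>a\<in>carrier G. mat_trace (X a) * mat_trace (Y (inv a))) = 0"
      by (auto simp: sum_char_mult_eq_average[OF X rep] intro!: sum.neutral)
    moreover have "(\<Sum>a\<in>carrier G. mat_trace (X a) * mat_trace (Y (inv a))) = of_nat (Coset.order G)"
      unfolding sum_irreducible_char[OF fin Y, symmetric] by (intro sum.cong) (auto simp: char)
    ultimately show False using order_gt_0_iff_finite fin by simp
  qed
  then obtain A where A: "A \<in> carrier_mat n n" "average_mat n X A Y \<noteq> 0\<^sub>m n n" by blast
  have "average_mat n X A Y \<in> carrier (GL n)"
    using average_mat_intertwines[OF X rep A(1)] A(2)
    by (intro schur_invertible[OF Y _ _ representation_carrier_mat[OF X]]) auto
  then show ?thesis using mn average_mat_intertwines[OF X rep A(1)] by blast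
qed

end

section \<open>Splitting of cocycles\<close>

text \<open>The coboundary equation without denominators and without extensionality: values off the
  carrier are ignored, so the predicate applies as it stands to powers of a cocycle and to its
  restriction to a subgroup.\<close>

definition splits :: "('a, 'b) monoid_scheme \<Rightarrow> ('a \<times> 'a \<Rightarrow> complex) \<Rightarrow> ('a \<Rightarrow> complex) \<Rightarrow> bool" where
  "splits G \<beta> \<mu> \<longleftrightarrow> (\<forall>x\<in>carrier G. \<mu> x \<noteq> 0) \<and>
     (\<forall>x\<in>carrier G. \<forall>y\<in>carrier G. \<beta> (x, y) * \<mu> (x \<otimes>\<^bsub>G\<^esub> y) = \<mu> x * \<mu> y)"

lemma splits_power:
  assumes "splits G \<beta> \<mu>"
  shows "splits G (\<lambda>t. \<beta> t ^ k) (\<lambda>x. \<mu> x ^ k)"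
  using assms by (simp add: splits_def flip: power_mult_distrib)

lemma Z2_cocycle:
  assumes "\<beta> \<in> carrier (Z2 G)" "x \<in> carrier G" "y \<in> carrier G" "z \<in> carrier G"
  shows "\<beta> (x, y) * \<beta> (x \<otimes>\<^bsub>G\<^esub> y, z) = \<beta> (x, y \<otimes>\<^bsub>G\<^esub> z) * \<beta> (y, z)"
  using assms by (simp add: Z2_def)

context group
begin

lemma B2_iff_splits:
  assumes "\<beta> \<in> carrier (Z2 G)"
  shows "\<beta> \<in> B2 G \<longleftrightarrow> (\<exists>\<mu>. splits G \<beta> \<mu>)"
proof
  assume "\<beta> \<in> B2 G"
  then obtain \<mu> where "\<And>x. x \<in> carrier G \<Longrightarrow> \<mu> x \<noteq> 0" "\<beta> = coboundary G \<mu>"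
    by (auto simp: B2_def)
  then have "splits G \<beta> \<mu>" by (simp add: splits_def coboundary_def)
  then show "\<exists>\<mu>. splits G \<beta> \<mu>" by blast
next
  assume "\<exists>\<mu>. splits G \<beta> \<mu>"
  then obtain \<mu> where \<mu>: "splits G \<beta> \<mu>" ..
  have "\<beta> = coboundary G \<mu>"
  proof (rule ext)
    fix t
    show "\<beta> t = coboundary G \<mu> t"
      using assms \<mu> by (cases t)
        (auto simp: coboundary_def restrict_def splits_def Z2_def PiE_iff extensional_def eq_divide_eq)
  qed
  then show "\<beta> \<in> B2 G" using \<mu> by (auto simp: B2_def splits_def)
qed

text \<open>Explicit transfer: after multiplication by a coboundary, \<open>\<beta>\<close> becomes left \<open>S\<close>-invariant in its
  first argument, and the product over the cosets of \<open>S\<close> in that argument is the required cochain.\<close>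

lemma splits_power_index:
  assumes fin: "finite (carrier G)" and \<beta>: "\<beta> \<in> carrier (Z2 G)" and S: "subgroup S G"
    and \<mu>: "splits (G\<lparr>carrier := S\<rparr>) \<beta> \<mu>"
  shows "\<exists>\<nu>. splits G (\<lambda>t. \<beta> t ^ card (rcosets S)) \<nu>"
proof -
  interpret S: subgroup S G by (rule S)
  note nz = Z2_memD[OF \<beta>] and coc = Z2_cocycle[OF \<beta>]
  have \<mu>nz: "\<mu> s \<noteq> 0" if "s \<in> S" for s using \<mu> that by (simp add: splits_def)
  have \<mu>m: "\<beta> (s, u) * \<mu> (s \<otimes> u) = \<mu> s * \<mu> u" if "s \<in> S" "u \<in> S" for s u
    using \<mu> that by (simp add: splits_def)
  define rep :: "'a set \<Rightarrow> 'a" where "rep C = (SOME x. x \<in> C)" for C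
  have rep: "rep C \<in> C" if C: "C \<in> rcosets S" for C
  proof -
    obtain x where "x \<in> carrier G" "C = S #> x" using C by (auto simp: RCOSETS_def)
    then have "x \<in> C" using rcos_self[OF _ S] by simp
    then show ?thesis unfolding rep_def by (rule someI)
  qed
  have cos: "S #> x \<in> rcosets S" if "x \<in> carrier G" for x
    using that S.subset by (rule rcosetsI[rotated])
  have cosS: "S #> (s \<otimes> x) = S #> x" if "s \<in> S" "x \<in> carrier G" for s x
    using that S.subset S by (metis S.mem_carrier coset_mult_assoc coset_join2)
  define \<tau> where "\<tau> x = rep (S #> x)" for x
  have \<tau>: "\<tau> x \<in> carrier G" "x \<otimes> inv (\<tau> x) \<in> S" if x: "x \<in> carrier G" for x
  proof -
    have "\<tau> x \<in> S #> x" unfolding \<tau>_def using rep cos x by blast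
    then obtain s where s: "s \<in> S" "\<tau> x = s \<otimes> x" by (auto simp: r_coset_def)
    then show "\<tau> x \<in> carrier G" "x \<otimes> inv (\<tau> x) \<in> S"
      using x by (simp_all add: inv_mult_group m_assoc[symmetric])
  qed
  \<comment> \<open>This extends \<mu> from S to G along the factorization of x into an element of S
    and its coset representative \<open>\<tau> x\<close>. It is the choice that gives the law
    \<open>\<kappa>\<close> below, under which s in S acts through \<mu> s / \<beta> (s, x).\<close>
  define \<kappa> where "\<kappa> x = \<mu> (x \<otimes> inv (\<tau> x)) / \<beta> (x \<otimes> inv (\<tau> x), \<tau> x)" for x
  have \<kappa>nz: "\<kappa> x \<noteq> 0" if "x \<in> carrier G" for x
    using \<tau>[OF that] \<mu>nz nz by (simp add: \<kappa>_def)
  have \<kappa>: "\<kappa> (s \<otimes> x) = \<mu> s * \<kappa> x / \<beta> (s, x)" if s: "s \<in> S" and x: "x \<in> carrier G" for s x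
  proof -
    define t u where "t = \<tau> x" and "u = x \<otimes> inv t"
    have t: "t \<in> carrier G" and u: "u \<in> S" "u \<in> carrier G" and sc: "s \<in> carrier G"
      using \<tau>[OF x] s by (auto simp: t_def u_def)
    have xeq: "x = u \<otimes> t" using x t by (simp add: u_def m_assoc)
    have su: "s \<otimes> u \<in> S" "s \<otimes> u \<in> carrier G" using s u by auto
    have "\<tau> (s \<otimes> x) = t" using cosS[OF s x] by (simp add: \<tau>_def t_def)
    moreover have "s \<otimes> x \<otimes> inv t = s \<otimes> u" using x t sc by (simp add: u_def m_assoc)
    ultimately have 1: "\<kappa> (s \<otimes> x) = \<mu> (s \<otimes> u) / \<beta> (s \<otimes> u, t)" by (simp add: \<kappa>_def)
    have 2: "\<kappa> x = \<mu> u / \<beta> (u, t)" by (simp add: \<kappa>_def t_def u_def)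
    have 3: "\<beta> (s, u) * \<beta> (s \<otimes> u, t) = \<beta> (s, x) * \<beta> (u, t)"
      using coc[OF sc u(2) t] xeq by simp
    have "\<mu> (s \<otimes> u) * \<beta> (s, x) * \<beta> (u, t) = \<mu> (s \<otimes> u) * (\<beta> (s, u) * \<beta> (s \<otimes> u, t))"
      unfolding 3 by simp
    also have "\<dots> = \<mu> s * \<mu> u * \<beta> (s \<otimes> u, t)"
      using \<mu>m[OF s u(1)] by (simp add: mult.commute)
    finally show ?thesis unfolding 1 2 using nz x t u sc su by (simp add: field_simps)
  qed
  \<comment> \<open>\<beta> divided by the coboundary of \<kappa>, hence again a cocycle.\<close>
  define F where "F x y = \<beta> (x, y) * \<kappa> (x \<otimes> y) / (\<kappa> x * \<kappa> y)" for x y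
  have Fnz: "F x y \<noteq> 0" if "x \<in> carrier G" "y \<in> carrier G" for x y
    using that nz \<kappa>nz by (simp add: F_def)
  have Fcoc: "F x y * F (x \<otimes> y) z = F x (y \<otimes> z) * F y z"
    if "x \<in> carrier G" "y \<in> carrier G" "z \<in> carrier G" for x y z
  proof -
    have "F x y * F (x \<otimes> y) z = (\<beta> (x, y) * \<beta> (x \<otimes> y, z)) * \<kappa> (x \<otimes> y \<otimes> z) / (\<kappa> x * \<kappa> y * \<kappa> z)"
      using that \<kappa>nz by (simp add: F_def mult.assoc)
    also have "\<dots> = F x (y \<otimes> z) * F y z"
      unfolding coc[OF that] using that \<kappa>nz by (simp add: F_def m_assoc mult_ac)
    finally show ?thesis .
  qed
  \<comment> \<open>The factors \<mu> s cancel, and what remains is the cocycle identity of \<beta>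
    for s, x, y.\<close>
  have Finv: "F (s \<otimes> x) y = F x y" if s: "s \<in> S" and x: "x \<in> carrier G" and y: "y \<in> carrier G" for s x y
  proof -
    have sc: "s \<in> carrier G" using s by simp
    have "F (s \<otimes> x) y = \<beta> (s \<otimes> x, y) * \<kappa> (s \<otimes> (x \<otimes> y)) / (\<kappa> (s \<otimes> x) * \<kappa> y)"
      using x y sc by (simp add: F_def m_assoc)
    also have "\<dots> = (\<beta> (s, x) * \<beta> (s \<otimes> x, y)) * \<kappa> (x \<otimes> y) / (\<beta> (s, x \<otimes> y) * (\<kappa> x * \<kappa> y))"
      using x y sc \<mu>nz[OF s] nz \<kappa>nz by (simp add: \<kappa>[OF s] field_simps)
    also have "\<dots> = F x y"
      unfolding coc[OF sc x y] using x y sc nz by (simp add: F_def)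
    finally show ?thesis .
  qed
  have Frep: "F (rep C) y = F x y" if C: "C \<in> rcosets S" and x: "x \<in> C" and y: "y \<in> carrier G" for C x y
  proof -
    obtain z where z: "z \<in> carrier G" "C = S #> z" using C by (auto simp: RCOSETS_def)
    have "C = S #> x" using repr_independence[OF _ z(1) S] x z(2) by simp
    then have "rep C \<in> S #> x" using rep[OF C] by simp
    moreover have "x \<in> carrier G" using S.rcosets_carrier[OF is_group C] x by blast
    ultimately show ?thesis using Finv y by (auto simp: r_coset_def)
  qed
  define \<nu> where "\<nu> y = (\<Prod>C\<in>rcosets S. F (rep C) y)" for y
  have repc: "rep C \<in> carrier G" if "C \<in> rcosets S" for C
    using rep[OF that] S.rcosets_carrier[OF is_group that] by blast
  have fin': "finite (rcosets S)" using fin by (simp add: RCOSETS_def)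
  have \<nu>nz: "\<nu> y \<noteq> 0" if "y \<in> carrier G" for y
    using that fin' Fnz repc by (simp add: \<nu>_def)
  have \<nu>: "F y z ^ card (rcosets S) * \<nu> (y \<otimes> z) = \<nu> y * \<nu> z"
    if y: "y \<in> carrier G" and z: "z \<in> carrier G" for y z
  proof -
    have act: "C #> y \<in> rcosets S" "rep C \<otimes> y \<in> C #> y" "C #> y #> inv y = C" "C #> inv y #> y = C"
      "C #> inv y \<in> rcosets S"
      if C: "C \<in> rcosets S" for C
    proof -
      obtain x where x: "x \<in> carrier G" "C = S #> x" using C by (auto simp: RCOSETS_def)
      show "C #> y \<in> rcosets S" "C #> inv y \<in> rcosets S" "C #> y #> inv y = C" "C #> inv y #> y = C"
        using x y cos S.subset by (simp_all add: coset_mult_assoc m_assoc)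
      show "rep C \<otimes> y \<in> C #> y" using rep[OF C] by (auto simp: r_coset_def)
    qed
    \<comment> \<open>Right multiplication by y permutes the cosets, and by invariance the
      representative of \<open>C #> y\<close> may be replaced by \<open>rep C \<otimes> y\<close>.
      The cocycle identity for \<open>rep C\<close>, y, z can then be multiplied over all C.\<close>
    have "\<nu> z = (\<Prod>C\<in>rcosets S. F (rep (C #> y)) z)"
      unfolding \<nu>_def
      by (rule prod.reindex_bij_witness[where i="\<lambda>C. C #> y" and j="\<lambda>C. C #> inv y"]) (auto simp: act)
    also have "\<dots> = (\<Prod>C\<in>rcosets S. F (rep C \<otimes> y) z)"
      by (intro prod.cong refl Frep) (auto simp: act z)
    finally have "\<nu> y * \<nu> z = (\<Prod>C\<in>rcosets S. F (rep C) y * F (rep C \<otimes> y) z)"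
      by (simp add: \<nu>_def prod.distrib)
    also have "\<dots> = (\<Prod>C\<in>rcosets S. F (rep C) (y \<otimes> z) * F y z)"
      by (intro prod.cong refl Fcoc repc y z)
    finally show ?thesis by (simp add: \<nu>_def prod.distrib mult.commute)
  qed
  \<comment> \<open>The power of \<kappa> restores the coboundary by which F differs from
    \<beta>.\<close>
  have "splits G (\<lambda>t. \<beta> t ^ card (rcosets S)) (\<lambda>x. \<nu> x * \<kappa> x ^ card (rcosets S))"
    unfolding splits_def
  proof (intro conjI ballI)
    fix x y assume x: "x \<in> carrier G" and y: "y \<in> carrier G"
    let ?k = "card (rcosets S)"
    have "\<beta> (x, y) * \<kappa> (x \<otimes> y) = F x y * (\<kappa> x * \<kappa> y)"
      using x y \<kappa>nz by (simp add: F_def)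
    then have "\<beta> (x, y) ^ ?k * \<kappa> (x \<otimes> y) ^ ?k = F x y ^ ?k * (\<kappa> x ^ ?k * \<kappa> y ^ ?k)"
      by (metis power_mult_distrib)
    then have "\<beta> (x, y) ^ ?k * (\<nu> (x \<otimes> y) * \<kappa> (x \<otimes> y) ^ ?k) =
        F x y ^ ?k * \<nu> (x \<otimes> y) * (\<kappa> x ^ ?k * \<kappa> y ^ ?k)"
      by (metis (no_types, lifting) mult.assoc mult.left_commute)
    then show "\<beta> (x, y) ^ ?k * (\<nu> (x \<otimes> y) * \<kappa> (x \<otimes> y) ^ ?k) = \<nu> x * \<kappa> x ^ ?k * (\<nu> y * \<kappa> y ^ ?k)"
      unfolding \<nu>[OF x y] by (simp add: mult_ac)
  qed (use \<nu>nz \<kappa>nz in simp)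
  then show ?thesis by blast
qed

text \<open>Transfer from the trivial subgroup, whose index is the group order.\<close>

lemma splits_power_order:
  assumes fin: "finite (carrier G)" and \<beta>: "\<beta> \<in> carrier (Z2 G)"
  shows "\<exists>\<nu>. splits G (\<lambda>t. \<beta> t ^ Coset.order G) \<nu>"
proof -
  \<comment> \<open>At the identity the equation reads \<beta> (\<one>, \<one>) \<mu> \<one> = \<mu>
    \<one> \<mu> \<one>, which forces this value.\<close>
  have "splits (G\<lparr>carrier := {\<one>}\<rparr>) \<beta> (\<lambda>_. \<beta> (\<one>, \<one>))"
    using Z2_memD[OF \<beta>] by (simp add: splits_def)
  then have "\<exists>\<nu>. splits G (\<lambda>t. \<beta> t ^ card (rcosets {\<one>})) \<nu>"
    by (rule splits_power_index[OF fin \<beta> triv_subgroup])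
  moreover have "card (rcosets {\<one>}) = Coset.order G"
    using lagrange[OF triv_subgroup] by simp
  ultimately show ?thesis by simp
qed

lemma multiplicative_power_order:
  fixes f :: "'a \<Rightarrow> complex"
  assumes fin: "finite (carrier G)"
    and mult: "\<And>x y. x \<in> carrier G \<Longrightarrow> y \<in> carrier G \<Longrightarrow> f (x \<otimes> y) = f x * f y"
    and nz: "\<And>x. x \<in> carrier G \<Longrightarrow> f x \<noteq> 0" and x: "x \<in> carrier G"
  shows "f x ^ Coset.order G = 1"
proof -
  have one: "f \<one> = 1" using mult[of \<one> \<one>] nz[of \<one>] by simp
  have "f (x [^] n) = f x ^ n" for n :: nat
    by (induction n) (simp_all add: one mult x)
  then show ?thesis using pow_order_eq_1[OF x] one by metis
qed

text \<open>If \<open>\<beta>\<^sup>m = 1\<close> and \<open>e |G| \<equiv> 1 (mod m)\<close>, then \<open>\<beta> = \<beta>\<^bsup>e|G|\<^esup>\<close>; raising to the power \<open>e |G|\<close>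
  twice splits \<open>\<beta>\<close> and kills the linear character \<open>\<mu>\<^sup>m\<close>.\<close>

lemma splits_root_of_unity:
  assumes fin: "finite (carrier G)" and \<beta>: "\<beta> \<in> carrier (Z2 G)"
    and root: "\<And>x y. x \<in> carrier G \<Longrightarrow> y \<in> carrier G \<Longrightarrow> \<beta> (x, y) ^ m = 1"
    and coprime: "coprime (Coset.order G) m"
  shows "\<exists>\<mu>. splits G \<beta> \<mu> \<and> (\<forall>x\<in>carrier G. \<mu> x ^ m = 1)"
proof -
  have "Coset.order G \<noteq> 0" using fin order_gt_0_iff_finite by simp
  then obtain e q where eq: "Coset.order G * e = m * q + 1"
    using bezout_nat[of "Coset.order G" m] coprime by auto
  obtain \<mu> where \<mu>: "splits G (\<lambda>t. \<beta> t ^ Coset.order G) \<mu>"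
    using splits_power_order[OF fin \<beta>] ..
  have pow: "\<beta> (x, y) ^ (Coset.order G * e) = \<beta> (x, y)" if "x \<in> carrier G" "y \<in> carrier G" for x y
    unfolding eq using root[OF that] by (simp add: power_mult)
  have 1: "splits G \<beta> (\<lambda>x. \<mu> x ^ e)"
    using splits_power[OF \<mu>, of e] pow by (simp add: splits_def flip: power_mult)
  have "splits G (\<lambda>t. \<beta> t ^ m) (\<lambda>x. (\<mu> x ^ e) ^ m)" by (rule splits_power[OF 1])
  \<comment> \<open>The m-th power of the splitting splits the trivial cocycle, so it is a linear
    character and its values are roots of unity of order dividing |G|.\<close>
  then have 2: "((\<mu> x ^ e) ^ m) ^ Coset.order G = 1" if "x \<in> carrier G" for x
    using root that fin by (intro multiplicative_power_order) (auto simp: splits_def)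
  have "splits G \<beta> (\<lambda>x. (\<mu> x ^ e) ^ (Coset.order G * e))"
    using splits_power[OF 1, of "Coset.order G * e"] pow by (simp add: splits_def)
  moreover have "((\<mu> x ^ e) ^ (Coset.order G * e)) ^ m = 1" if "x \<in> carrier G" for x
  proof -
    have "((\<mu> x ^ e) ^ (Coset.order G * e)) ^ m = (((\<mu> x ^ e) ^ m) ^ Coset.order G) ^ e"
      by (simp add: mult_ac flip: power_mult)
    then show ?thesis using 2[OF that] by simp
  qed
  ultimately show ?thesis by blast
qed

lemma Z2_pow:
  assumes "\<beta> \<in> carrier (Z2 G)"
  shows "\<beta> [^]\<^bsub>Z2 G\<^esub> (k::nat) = (\<lambda>t\<in>carrier G \<times> carrier G. \<beta> t ^ k)"
proof (induction k)
  case 0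
  show ?case by (simp add: nat_pow_def Z2_def)
next
  case (Suc k)
  interpret Z: comm_group "Z2 G" by (rule comm_group_Z2)
  show ?case unfolding Z.nat_pow_Suc Suc by (auto simp: Z2_def mult.commute)
qed

text \<open>A power of the class is trivial exactly when the same power of \<beta> is a coboundary.
  With divisibility, the value 0 that \<open>ord\<close> assigns to infinite order needs no separate
  case.\<close>

lemma ord_cohomology_class_dvd_iff:
  assumes "\<beta> \<in> carrier (Z2 G)"
  shows "group.ord (H2 G) (cohomology_class G \<beta>) dvd k \<longleftrightarrow> (\<exists>\<mu>. splits G (\<lambda>t. \<beta> t ^ k) \<mu>)"
proof -
  interpret Z: comm_group "Z2 G" by (rule comm_group_Z2)
  interpret B: normal "B2 G" "Z2 G" by (rule B2_normal)
  interpret H: group "H2 G" by (rule group_H2)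
  interpret h: group_hom "Z2 G" "H2 G" "\<lambda>\<alpha>. B2 G #>\<^bsub>Z2 G\<^esub> \<alpha>"
    using B.r_coset_hom_Mod by unfold_locales (simp add: H2_def)
  have "group.ord (H2 G) (cohomology_class G \<beta>) dvd k \<longleftrightarrow> cohomology_class G \<beta> [^]\<^bsub>H2 G\<^esub> k = \<one>\<^bsub>H2 G\<^esub>"
    using h.hom_closed[OF assms] H.pow_eq_id by (simp add: cohomology_class_def)
  also have "\<dots> \<longleftrightarrow> B2 G #>\<^bsub>Z2 G\<^esub> (\<beta> [^]\<^bsub>Z2 G\<^esub> k) = B2 G"
    using h.hom_nat_pow[OF assms] by (simp add: cohomology_class_def H2_def FactGroup_def)
  also have "\<dots> \<longleftrightarrow> \<beta> [^]\<^bsub>Z2 G\<^esub> k \<in> B2 G"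
    using Z.coset_join1[OF _ _ B.subgroup_axioms] Z.coset_join2[OF _ B.subgroup_axioms]
      Z.nat_pow_closed[OF assms, of k] by metis
  also have "\<dots> \<longleftrightarrow> (\<exists>\<mu>. splits G (\<beta> [^]\<^bsub>Z2 G\<^esub> k) \<mu>)"
    using assms by (intro B2_iff_splits) simp
  also have "\<dots> \<longleftrightarrow> (\<exists>\<mu>. splits G (\<lambda>t. \<beta> t ^ k) \<mu>)"
    unfolding Z2_pow[OF assms] by (simp add: splits_def)
  finally show ?thesis .
qed

end

section \<open>Existence of the projective representation\<close>

lemma GL_inv:
  assumes "A \<in> carrier (GL n)"
  shows "inv\<^bsub>GL n\<^esub> A \<in> carrier (GL n)" "inv\<^bsub>GL n\<^esub> A \<in> carrier_mat n n"
    "A * inv\<^bsub>GL n\<^esub> A = 1\<^sub>m n" "inv\<^bsub>GL n\<^esub> A * A = 1\<^sub>m n"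
  using group.inv_closed[OF group_GL assms] group.r_inv[OF group_GL assms] group.l_inv[OF group_GL assms]
  by (auto simp: GL_carrier_mat)

lemma GL_inv_cancel:
  assumes "A \<in> carrier (GL n)" "M \<in> carrier_mat n m"
  shows "A * (inv\<^bsub>GL n\<^esub> A * M) = M" "inv\<^bsub>GL n\<^esub> A * (A * M) = M"
  using assms GL_inv[OF assms(1)] GL_carrier_mat[OF assms(1)]
  by (simp_all flip: assoc_mult_mat[of _ n n _ n _ m])

lemma GL_mult_closed: "A \<in> carrier (GL n) \<Longrightarrow> B \<in> carrier (GL n) \<Longrightarrow> A * B \<in> carrier (GL n)"
  using monoid.m_closed[OF group.is_monoid[OF group_GL], of A n B] by simp

lemma representation_GL:
  "representation G n X \<Longrightarrow> g \<in> carrier G \<Longrightarrow> X g \<in> carrier (GL n)"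
  by (auto simp: representation_def hom_def)

text \<open>Both bracketings of the triple product are multiples of the same invertible matrix, so
  their scalars agree.\<close>

lemma projective_cocycle:
  assumes n: "n > 0" and X: "X \<in> carrier G \<rightarrow> carrier (GL n)" and G: "group G"
    and mult: "\<And>x y. x \<in> carrier G \<Longrightarrow> y \<in> carrier G \<Longrightarrow> X x * X y = \<alpha> (x, y) \<cdot>\<^sub>m X (x \<otimes>\<^bsub>G\<^esub> y)"
    and xyz: "x \<in> carrier G" "y \<in> carrier G" "z \<in> carrier G"
  shows "\<alpha> (x, y) * \<alpha> (x \<otimes>\<^bsub>G\<^esub> y, z) = \<alpha> (x, y \<otimes>\<^bsub>G\<^esub> z) * \<alpha> (y, z)"
proof -
  interpret group G by (rule G)
  have car: "X g \<in> carrier_mat n n" if "g \<in> carrier G" for g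
    using X that by (auto intro: GL_carrier_mat)
  have "(\<alpha> (x, y) * \<alpha> (x \<otimes>\<^bsub>G\<^esub> y, z)) \<cdot>\<^sub>m X (x \<otimes>\<^bsub>G\<^esub> y \<otimes>\<^bsub>G\<^esub> z) = X x * X y * X z"
    using xyz car by (simp add: mult smult_smult_mat mult_smult_assoc_mat[of _ n n _ n])
  also have "\<dots> = X x * (X y * X z)"
    using xyz car by (intro assoc_mult_mat[of _ n n _ n _ n]) auto
  also have "\<dots> = (\<alpha> (x, y \<otimes>\<^bsub>G\<^esub> z) * \<alpha> (y, z)) \<cdot>\<^sub>m X (x \<otimes>\<^bsub>G\<^esub> y \<otimes>\<^bsub>G\<^esub> z)"
    using xyz car by (simp add: mult smult_smult_mat mult_smult_distrib[of _ n n _ n] m_assoc mult.commute)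
  finally show ?thesis
    using X n xyz by (intro GL_smult_cancel[of "X (x \<otimes>\<^bsub>G\<^esub> y \<otimes>\<^bsub>G\<^esub> z)" n]) auto
qed

section \<open>Intertwiners for representations affording an irreducible character\<close>

context group
begin

lemma inv_mult_cancel:
  assumes "g \<in> carrier G" "b \<in> carrier G"
  shows "inv g \<otimes> (g \<otimes> b) = b" "g \<otimes> (inv g \<otimes> b) = b"
  using assms by (simp_all flip: m_assoc)

text \<open>Neither representation is given as irreducible, so both are compared with an irreducible
  one that affords \<theta>, and the two intertwiners are composed.\<close>

lemma affords_similar:
  assumes fin: "finite (carrier G)" and \<theta>: "irreducible_character G \<theta>"
    and X: "representation G m X" "affords G X \<theta>" and Y: "representation G n Y" "affords G Y \<theta>"
  shows "m = n \<and> (\<exists>T\<in>carrier (GL n). \<forall>g\<in>carrier G. X g * T = T * Y g)"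
proof -
  obtain k Z where Z: "irreducible_representation G k Z" "affords G Z \<theta>"
    using \<theta> by (auto simp: irreducible_character_def)
  have mk: "m = k" and "\<exists>T\<in>carrier (GL k). \<forall>g\<in>carrier G. X g * T = T * Z g"
    using irreducible_character_similar[OF fin X(1) Z(1)] X(2) Z(2) by (auto simp: affords_def)
  then obtain T where T: "T \<in> carrier (GL k)" "\<And>g. g \<in> carrier G \<Longrightarrow> X g * T = T * Z g" by blast
  have nk: "n = k" and "\<exists>U\<in>carrier (GL k). \<forall>g\<in>carrier G. Y g * U = U * Z g"
    using irreducible_character_similar[OF fin Y(1) Z(1)] Y(2) Z(2) by (auto simp: affords_def)
  then obtain U where U: "U \<in> carrier (GL k)" "\<And>g. g \<in> carrier G \<Longrightarrow> Y g * U = U * Z g" by blast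
  let ?U = "inv\<^bsub>GL k\<^esub> U"
  have "X g * (T * ?U) = T * ?U * Y g" if g: "g \<in> carrier G" for g
  proof -
    note car = GL_carrier_mat[OF T(1)] GL_carrier_mat[OF U(1)] GL_inv(2)[OF U(1)]
      representation_carrier_mat[OF X(1)[unfolded mk] g] representation_carrier_mat[OF Y(1)[unfolded nk] g]
      representation_carrier_mat[OF irreducible_representation_imp_representation[OF Z(1)] g]
    have "?U * (Y g * U) = Z g" using U(2)[OF g] GL_inv_cancel(2)[OF U(1), of "Z g"] car by simp
    then have "?U * (Y g * U) * ?U = Z g * ?U" by simp
    then have *: "?U * Y g = Z g * ?U"
      using car GL_inv(3)[OF U(1)] by (simp add: assoc_mult_mat[of _ k k _ k _ k])
    have "X g * (T * ?U) = X g * T * ?U" using car by (simp add: assoc_mult_mat[of _ k k _ k _ k])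
    also have "\<dots> = T * (Z g * ?U)" unfolding T(2)[OF g] using car by (simp add: assoc_mult_mat[of _ k k _ k _ k])
    also have "\<dots> = T * ?U * Y g" unfolding *[symmetric] using car by (simp add: assoc_mult_mat[of _ k k _ k _ k])
    finally show ?thesis .
  qed
  then show ?thesis using mk nk GL_mult_closed[OF T(1) GL_inv(1)[OF U(1)]] by blast
qed

text \<open>Conjugation by an intertwiner moves \<open>M\<close> into the commutant of an
  irreducible representation; a scalar matrix stays the same when moved back.\<close>

lemma affords_scalar:
  assumes fin: "finite (carrier G)" and \<theta>: "irreducible_character G \<theta>"
    and X: "representation G n X" "affords G X \<theta>"
    and M: "M \<in> carrier_mat n n" and comm: "\<And>g. g \<in> carrier G \<Longrightarrow> X g * M = M * X g"
  shows "\<exists>c. M = c \<cdot>\<^sub>m 1\<^sub>m n"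
proof -
  obtain k Z where Z: "irreducible_representation G k Z" "affords G Z \<theta>"
    using \<theta> by (auto simp: irreducible_character_def)
  have nk: "n = k" and "\<exists>T\<in>carrier (GL k). \<forall>g\<in>carrier G. X g * T = T * Z g"
    using irreducible_character_similar[OF fin X(1) Z(1)] X(2) Z(2) by (auto simp: affords_def)
  note Z = Z[folded nk]
  then obtain T where T: "T \<in> carrier (GL n)" "\<And>g. g \<in> carrier G \<Longrightarrow> X g * T = T * Z g"
    using nk \<open>\<exists>T\<in>carrier (GL k). _ T\<close> by blast
  let ?T = "inv\<^bsub>GL n\<^esub> T"
  note car = GL_carrier_mat[OF T(1)] GL_inv(2)[OF T(1)] M
  note assoc = assoc_mult_mat[of _ n n _ n _ n]
  have "Z g * (?T * M * T) = ?T * M * T * Z g" if g: "g \<in> carrier G" for g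
  proof -
    note carg = representation_carrier_mat[OF X(1) g]
      representation_carrier_mat[OF irreducible_representation_imp_representation[OF Z(1)] g]
    have "?T * (X g * T) = Z g" using T(2)[OF g] GL_inv_cancel(2)[OF T(1), of "Z g"] carg by simp
    then have "?T * (X g * T) * ?T = Z g * ?T" by simp
    then have *: "Z g * ?T = ?T * X g"
      using car carg GL_inv(3)[OF T(1)] by (simp add: assoc)
    have "Z g * (?T * M * T) = Z g * ?T * (M * T)" using car carg by (simp add: assoc)
    also have "\<dots> = ?T * (X g * M * T)" unfolding * using car carg by (simp add: assoc)
    also have "\<dots> = ?T * M * (X g * T)" unfolding comm[OF g] using car carg by (simp add: assoc)
    also have "\<dots> = ?T * M * T * Z g" unfolding T(2)[OF g] using car carg by (simp add: assoc)
    finally show ?thesis .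
  qed
  then obtain c where c: "?T * M * T = c \<cdot>\<^sub>m 1\<^sub>m n"
    using schur_scalar[OF Z(1), of "?T * M * T"] car by (auto intro: mult_carrier_mat)
  have "M = T * (?T * (M * (T * ?T)))"
    using car GL_inv_cancel(1)[OF T(1), of M] GL_inv(3)[OF T(1)] by simp
  also have "\<dots> = T * (?T * M * T) * ?T" using car by (simp add: assoc)
  also have "\<dots> = c \<cdot>\<^sub>m 1\<^sub>m n"
    unfolding c using car GL_inv(3)[OF T(1)]
    by (simp add: mult_smult_distrib[of _ n n _ n] mult_smult_assoc_mat[of _ n n _ n])
  finally show ?thesis by blast
qed

text \<open>The inverse of \<open>B\<close> times \<open>A\<close> commutes with \<open>X\<close>,
  hence is scalar. \<open>Z\<close> is an arbitrary family of matrices so that it can be the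
  conjugate of a representation of N by an element outside N.\<close>

lemma affords_proportional:
  assumes fin: "finite (carrier G)" and \<theta>: "irreducible_character G \<theta>"
    and X: "representation G n X" "affords G X \<theta>"
    and A: "A \<in> carrier (GL n)" and B: "B \<in> carrier (GL n)"
    and Z: "\<And>g. g \<in> carrier G \<Longrightarrow> Z g \<in> carrier_mat n n"
    and AZ: "\<And>g. g \<in> carrier G \<Longrightarrow> A * X g = Z g * A"
    and BZ: "\<And>g. g \<in> carrier G \<Longrightarrow> B * X g = Z g * B"
  shows "\<exists>c. c \<noteq> 0 \<and> A = c \<cdot>\<^sub>m B"
proof -
  let ?B = "inv\<^bsub>GL n\<^esub> B"
  note car = GL_carrier_mat[OF A] GL_carrier_mat[OF B] GL_inv(2)[OF B]
  note assoc = assoc_mult_mat[of _ n n _ n _ n]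
  have "X g * (?B * A) = ?B * A * X g" if g: "g \<in> carrier G" for g
  proof -
    note carg = representation_carrier_mat[OF X(1) g] Z[OF g]
    have "?B * (Z g * B) = X g" unfolding BZ[OF g, symmetric] using GL_inv_cancel(2)[OF B] carg by simp
    then have "?B * (Z g * B) * ?B = X g * ?B" by simp
    then have *: "X g * ?B = ?B * Z g"
      using car carg GL_inv(3)[OF B] by (simp add: assoc)
    have "X g * (?B * A) = X g * ?B * A" using car carg by (simp add: assoc)
    also have "\<dots> = ?B * (Z g * A)" unfolding * using car carg by (simp add: assoc)
    also have "\<dots> = ?B * A * X g" unfolding AZ[OF g, symmetric] using car carg by (simp add: assoc)
    finally show ?thesis .
  qed
  then obtain c where c: "?B * A = c \<cdot>\<^sub>m 1\<^sub>m n"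
    using affords_scalar[OF fin \<theta> X, of "?B * A"] car by auto
  have "A = B * (?B * A)" using GL_inv_cancel(1)[OF B] car by simp
  then have Ac: "A = c \<cdot>\<^sub>m B" unfolding c using car by (simp add: mult_smult_distrib[of _ n n _ n])
  have "c \<noteq> 0"
  proof
    assume "c = 0"
    have n: "n > 0" using X by (simp add: representation_def)
    \<comment> \<open>With c = 0 the matrix \<open>A\<close> would be zero, so distinct multiples of
      it would coincide, against its invertibility.\<close>
    have "2 \<cdot>\<^sub>m A = 1 \<cdot>\<^sub>m A" unfolding Ac \<open>c = 0\<close> by (intro eq_matI) auto
    then show False using GL_smult_cancel[OF A n] by fastforce
  qed
  then show ?thesis using Ac by blast
qed

end

section \<open>Cosets, quotients of intermediate subgroups, and inflation\<close>

context normal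
begin

lemma carrier_subgroup_Mod: "carrier (G\<lparr>carrier := K\<rparr> Mod H) = (\<lambda>x. H #> x) ` K"
  by (auto simp: FactGroup_def RCOSETS_def r_coset_def)

lemma carrier_Mod: "carrier (G Mod H) = (\<lambda>x. H #> x) ` carrier G"
  by (auto simp: FactGroup_def RCOSETS_def)

text \<open>Products of cosets are computed in G, so a cocycle on G/N can be evaluated on H/N
  without transport along an isomorphism.\<close>

lemma mult_subgroup_Mod: "(\<otimes>\<^bsub>G\<lparr>carrier := K\<rparr> Mod H\<^esub>) = (\<otimes>\<^bsub>G Mod H\<^esub>)"
  by (simp add: FactGroup_def set_mult_def fun_eq_iff)

lemma one_subgroup_Mod: "\<one>\<^bsub>G\<lparr>carrier := K\<rparr> Mod H\<^esub> = \<one>\<^bsub>G Mod H\<^esub>"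
  by (simp add: FactGroup_def)

lemma coset_mem_left: "a \<in> H \<Longrightarrow> x \<in> carrier G \<Longrightarrow> H #> (a \<otimes> x) = H #> x"
  by (metis coset_join2 coset_mult_assoc mem_carrier subgroup_axioms subset)

lemma coset_of_mem: "a \<in> H \<Longrightarrow> H #> a = H"
  by (simp add: coset_join2 subgroup_axioms)

lemma mem_coset_iff: "y \<in> H #> x \<longleftrightarrow> (\<exists>a\<in>H. y = a \<otimes> x)"
  by (auto simp: r_coset_def)

text \<open>Members of \<open>Z2\<close> are extensional, so \<beta> has to be cut down before
  results on cocycles of a group apply to it on K/H.\<close>

lemma restrict_Z2_Mod:
  assumes K: "subgroup K G" and \<beta>: "\<beta> \<in> carrier (Z2 (G Mod H))"
  shows "restrict \<beta> (carrier (G\<lparr>carrier := K\<rparr> Mod H) \<times> carrier (G\<lparr>carrier := K\<rparr> Mod H))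
    \<in> carrier (Z2 (G\<lparr>carrier := K\<rparr> Mod H))"
proof -
  have sub: "carrier (G\<lparr>carrier := K\<rparr> Mod H) \<subseteq> carrier (G Mod H)"
    using subgroup.subset[OF K] by (auto simp: carrier_subgroup_Mod carrier_Mod)
  have closed: "C \<otimes>\<^bsub>G Mod H\<^esub> D \<in> carrier (G\<lparr>carrier := K\<rparr> Mod H)"
    if "C \<in> carrier (G\<lparr>carrier := K\<rparr> Mod H)" "D \<in> carrier (G\<lparr>carrier := K\<rparr> Mod H)" for C D
    using that subgroup.m_closed[OF K] subgroup.mem_carrier[OF K]
    by (auto simp: carrier_subgroup_Mod rcos_sum)
  show ?thesis
    using Z2_cocycle[OF \<beta>] Z2_memD[OF \<beta>] sub closed
    by (auto simp: Z2_def mult_subgroup_Mod subset_iff)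
qed

lemma inflation_in_Z2:
  assumes "\<beta> \<in> carrier (Z2 (G Mod H))"
  shows "inflation G H \<beta> \<in> carrier (Z2 G)"
proof -
  have "\<beta> (H #> x, H #> y) * \<beta> (H #> (x \<otimes> y), H #> z) = \<beta> (H #> x, H #> (y \<otimes> z)) * \<beta> (H #> y, H #> z)"
    if "x \<in> carrier G" "y \<in> carrier G" "z \<in> carrier G" for x y z
    using Z2_cocycle[OF assms, of "H #> x" "H #> y" "H #> z"] that
    by (auto simp: carrier_Mod rcos_sum)
  moreover have "\<beta> (H #> x, H #> y) \<noteq> 0" if "x \<in> carrier G" "y \<in> carrier G" for x y
    using Z2_memD[OF assms, of "H #> x" "H #> y"] that by (auto simp: carrier_Mod)
  ultimately show ?thesis by (auto simp: Z2_def inflation_def PiE_iff)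
qed

end

lemma inflation_apply:
  "x \<in> carrier G \<Longrightarrow> y \<in> carrier G \<Longrightarrow> inflation G N \<beta> (x, y) = \<beta> (N #>\<^bsub>G\<^esub> x, N #>\<^bsub>G\<^esub> y)"
  by (simp add: inflation_def)

section \<open>Construction of the projective representation attached to \<theta>\<close>

context character_triple
begin

abbreviation "K \<equiv> G\<lparr>carrier := N\<rparr>"

lemma group_K: "group K"
  by (rule subgroup_is_group[OF is_group])

lemma finite_N: "finite (carrier K)"
  using finite_subset[OF subset finite_carrier] by simp

lemma conj_mem: "g \<in> carrier G \<Longrightarrow> a \<in> N \<Longrightarrow> g \<otimes> a \<otimes> inv g \<in> N"
  by (rule inv_op_closed2)

lemma conj_conj:
  assumes "g \<in> carrier G" "h \<in> carrier G" "a \<in> carrier G"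
  shows "g \<otimes> (h \<otimes> a \<otimes> inv h) \<otimes> inv g = g \<otimes> h \<otimes> a \<otimes> inv (g \<otimes> h)"
  using assms by (simp add: m_assoc inv_mult_group)

lemma conj_mult:
  assumes "g \<in> carrier G" "a \<in> carrier G" "b \<in> carrier G"
  shows "g \<otimes> (a \<otimes> b) \<otimes> inv g = g \<otimes> a \<otimes> inv g \<otimes> (g \<otimes> b \<otimes> inv g)"
  using assms by (simp add: m_assoc inv_mult_cancel)

text \<open>By invariance the conjugate of \<open>Y\<close> by g also affords \<theta>, so some
  matrix \<open>P g\<close> relates the two. Using \<open>P\<close> only at coset representatives
  and \<open>Y\<close> for the part in N makes \<open>X\<close> compatible with N. Both
  \<open>X x * X y\<close> and \<open>X (x \<otimes> y)\<close> relate \<open>Y\<close> to the same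
  conjugate, so they are proportional.\<close>

lemma ex_associated:
  "\<exists>n X \<beta>. associated_projective_representation G N \<theta> n (inflation G N \<beta>) X \<and> \<beta> \<in> carrier (Z2 (G Mod N))"
proof -
  interpret K: group K by (rule group_K)
  obtain n Y where Yirr: "irreducible_representation K n Y" and aff: "affords K Y \<theta>"
    using irreducible by (auto simp: irreducible_character_def)
  have Y: "representation K n Y" using Yirr by (rule irreducible_representation_imp_representation)
  have n: "n > 0" using Y by (simp add: representation_def)
  have YGL: "Y a \<in> carrier (GL n)" if "a \<in> N" for a using representation_GL[OF Y] that by simp
  have Yc: "Y a \<in> carrier_mat n n" if "a \<in> N" for a using representation_carrier_mat[OF Y] that by simp
  have Ym: "Y (a \<otimes> b) = Y a * Y b" if "a \<in> N" "b \<in> N" for a b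
    using representation_mult[OF Y] that by simp
  have Y1: "Y \<one> = 1\<^sub>m n" using K.representation_one[OF Y] by simp
  note assoc = assoc_mult_mat[of _ n n _ n _ n]
  have "\<exists>P\<in>carrier (GL n). \<forall>a\<in>N. Y (g \<otimes> a \<otimes> inv g) * P = P * Y a" if g: "g \<in> carrier G" for g
  proof -
    have "representation K n (\<lambda>a. Y (g \<otimes> a \<otimes> inv g))"
      using n conj_mem[OF g] YGL g by (auto simp: representation_def hom_def conj_mult Ym)
    moreover have "affords K (\<lambda>a. Y (g \<otimes> a \<otimes> inv g)) \<theta>"
      using aff conj_mem[OF g] invariant[OF g] by (simp add: affords_def)
    ultimately show ?thesis
      using K.affords_similar[OF finite_N irreducible _ _ Y aff, of n "\<lambda>a. Y (g \<otimes> a \<otimes> inv g)"] by simp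
  qed
  then have "\<forall>g\<in>carrier G. \<exists>P. P \<in> carrier (GL n) \<and> (\<forall>a\<in>N. Y (g \<otimes> a \<otimes> inv g) * P = P * Y a)"
    by blast
  then have "\<exists>P. \<forall>g\<in>carrier G. P g \<in> carrier (GL n) \<and> (\<forall>a\<in>N. Y (g \<otimes> a \<otimes> inv g) * P g = P g * Y a)"
    by (rule bchoice)
  then obtain P0 where P0: "\<And>g. g \<in> carrier G \<Longrightarrow> P0 g \<in> carrier (GL n)"
    "\<And>g a. g \<in> carrier G \<Longrightarrow> a \<in> N \<Longrightarrow> Y (g \<otimes> a \<otimes> inv g) * P0 g = P0 g * Y a" by blast
  \<comment> \<open>Together with \<one> as representative of N itself, this makes \<open>X\<close>
    equal to \<open>Y\<close> on N rather than merely similar to it.\<close>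
  define P where "P = P0(\<one> := 1\<^sub>m n)"
  have P: "P g \<in> carrier (GL n)" if "g \<in> carrier G" for g
    using that P0(1) monoid.one_closed[OF group.is_monoid[OF group_GL], of n] by (simp add: P_def)
  have PY: "Y (g \<otimes> a \<otimes> inv g) * P g = P g * Y a" if "g \<in> carrier G" "a \<in> N" for g a
    using that P0(2) left_mult_one_mat[OF Yc] right_mult_one_mat[OF Yc] by (auto simp: P_def)
  define rep :: "'a set \<Rightarrow> 'a" where "rep C = (if \<one> \<in> C then \<one> else SOME x. x \<in> C)" for C
  have rep: "rep (N #> g) \<in> N #> g" if "g \<in> carrier G" for g
    using rcos_self[OF that subgroup_axioms] unfolding rep_def by (auto intro: someI)
  define r where "r g = rep (N #> g)" for g
  have r: "r g \<in> carrier G" "g \<otimes> inv (r g) \<in> N" if g: "g \<in> carrier G" for g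
  proof -
    obtain a where a: "a \<in> N" "r g = a \<otimes> g" using rep[OF g] by (auto simp: r_def mem_coset_iff)
    then show "r g \<in> carrier G" "g \<otimes> inv (r g) \<in> N"
      using g by (simp_all add: inv_mult_group m_assoc[symmetric])
  qed
  have rN: "r a = \<one>" if "a \<in> N" for a using that by (simp add: r_def coset_of_mem rep_def)
  have rmult: "r (a \<otimes> g) = r g" if "a \<in> N" "g \<in> carrier G" for a g
    using that by (simp add: r_def coset_mem_left)
  define X where "X g = Y (g \<otimes> inv (r g)) * P (r g)" for g
  have XN: "X a = Y a" if "a \<in> N" for a
    using that right_mult_one_mat[OF Yc] by (simp add: X_def rN P_def)
  have XGL: "X g \<in> carrier (GL n)" if "g \<in> carrier G" for g
    unfolding X_def using that r YGL P by (intro GL_mult_closed) auto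
  have Xc: "X g \<in> carrier_mat n n" if "g \<in> carrier G" for g using XGL[OF that] by (rule GL_carrier_mat)
  have Pc: "P g \<in> carrier_mat n n" if "g \<in> carrier G" for g using P[OF that] by (rule GL_carrier_mat)
  have Xl: "X (a \<otimes> g) = Y a * X g" if a: "a \<in> N" and g: "g \<in> carrier G" for a g
  proof -
    have "a \<otimes> g \<otimes> inv (r g) = a \<otimes> (g \<otimes> inv (r g))" using a g r by (simp add: m_assoc)
    then show ?thesis
      using a g r Yc Pc by (simp add: X_def rmult Ym assoc)
  qed
  have Xconj: "X g * Y b = Y (g \<otimes> b \<otimes> inv g) * X g" if g: "g \<in> carrier G" and b: "b \<in> N" for g b
  proof -
    let ?a = "g \<otimes> inv (r g)"
    have b': "r g \<otimes> b \<otimes> inv (r g) \<in> N" using conj_mem r(1)[OF g] b by blast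
    have "X g * Y b = Y ?a * (P (r g) * Y b)"
      unfolding X_def using r[OF g] Yc b Pc by (simp add: assoc)
    also have "\<dots> = Y ?a * Y (r g \<otimes> b \<otimes> inv (r g)) * P (r g)"
      unfolding PY[OF r(1)[OF g] b, symmetric] using r[OF g] Yc b b' Pc by (simp add: assoc)
    also have "Y ?a * Y (r g \<otimes> b \<otimes> inv (r g)) = Y (?a \<otimes> (r g \<otimes> b \<otimes> inv (r g)))"
      using r[OF g] b' by (simp add: Ym)
    also have "?a \<otimes> (r g \<otimes> b \<otimes> inv (r g)) = (g \<otimes> b \<otimes> inv g) \<otimes> ?a"
      using g b r(1)[OF g] by (simp add: m_assoc inv_mult_cancel)
    also have "Y \<dots> = Y (g \<otimes> b \<otimes> inv g) * Y ?a" using conj_mem[OF g b] r[OF g] by (simp add: Ym)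
    finally show ?thesis
      unfolding X_def using conj_mem[OF g b] r[OF g] Yc Pc by (simp add: assoc)
  qed
  have "\<exists>c. c \<noteq> 0 \<and> X x * X y = c \<cdot>\<^sub>m X (x \<otimes> y)" if x: "x \<in> carrier G" and y: "y \<in> carrier G" for x y
  proof (rule K.affords_proportional[OF finite_N irreducible Y aff])
    show "X x * X y \<in> carrier (GL n)" using XGL x y by (intro GL_mult_closed)
    show "X (x \<otimes> y) \<in> carrier (GL n)" using XGL x y by simp
    fix a assume "a \<in> carrier K" then have a: "a \<in> N" by simp
    let ?Z = "Y (x \<otimes> y \<otimes> a \<otimes> inv (x \<otimes> y))"
    have N: "y \<otimes> a \<otimes> inv y \<in> N" "x \<otimes> y \<otimes> a \<otimes> inv (x \<otimes> y) \<in> N"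
      using conj_mem x y a by auto
    then show "?Z \<in> carrier_mat n n" using Yc by blast
    show "X (x \<otimes> y) * Y a = ?Z * X (x \<otimes> y)" using Xconj x y a by simp
    have "X x * X y * Y a = X x * Y (y \<otimes> a \<otimes> inv y) * X y"
      using Xc[OF x] Xc[OF y] Yc[OF a] Yc[OF N(1)] Xconj[OF y a] by (simp add: assoc)
    also have "\<dots> = ?Z * (X x * X y)"
      unfolding Xconj[OF x N(1)] using conj_conj[OF x y] a Xc[OF x] Xc[OF y] Yc[OF N(2)] by (simp add: assoc)
    finally show "X x * X y * Y a = ?Z * (X x * X y)" .
  qed
  then have "\<forall>t\<in>carrier G \<times> carrier G. \<exists>c. c \<noteq> 0 \<and> X (fst t) * X (snd t) = c \<cdot>\<^sub>m X (fst t \<otimes> snd t)"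
    by auto
  then have "\<exists>\<alpha>. \<forall>t\<in>carrier G \<times> carrier G. \<alpha> t \<noteq> 0 \<and> X (fst t) * X (snd t) = \<alpha> t \<cdot>\<^sub>m X (fst t \<otimes> snd t)"
    by (rule bchoice)
  then obtain \<alpha> where \<alpha>nz: "\<And>x y. x \<in> carrier G \<Longrightarrow> y \<in> carrier G \<Longrightarrow> \<alpha> (x, y) \<noteq> 0"
    and Xm: "\<And>x y. x \<in> carrier G \<Longrightarrow> y \<in> carrier G \<Longrightarrow> X x * X y = \<alpha> (x, y) \<cdot>\<^sub>m X (x \<otimes> y)" by force
  \<comment> \<open>Moving b to the left past x replaces it by its conjugate, which lies in N. The
    matrices of elements of N then come out on both sides, so \<alpha> depends only on the cosets of
    its arguments.\<close>
  have \<alpha>inv: "\<alpha> (a \<otimes> x, b \<otimes> y) = \<alpha> (x, y)"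
    if a: "a \<in> N" and b: "b \<in> N" and x: "x \<in> carrier G" and y: "y \<in> carrier G" for a b x y
  proof -
    let ?c = "x \<otimes> b \<otimes> inv x"
    have c: "?c \<in> N" using conj_mem[OF x b] .
    have ac: "a \<in> carrier G" "b \<in> carrier G" using a b by auto
    have eq: "a \<otimes> x \<otimes> (b \<otimes> y) = a \<otimes> ?c \<otimes> (x \<otimes> y)"
      using x y ac by (simp add: m_assoc inv_mult_cancel)
    have "\<alpha> (a \<otimes> x, b \<otimes> y) \<cdot>\<^sub>m X (a \<otimes> x \<otimes> (b \<otimes> y)) = X (a \<otimes> x) * X (b \<otimes> y)"
      using Xm x y ac by simp
    also have "\<dots> = Y a * (X x * Y b) * X y"
      using a b x y Xc[OF x] Xc[OF y] Yc[OF a] Yc[OF b] by (simp add: Xl assoc)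
    also have "\<dots> = Y a * Y ?c * (X x * X y)"
      unfolding Xconj[OF x b] using Xc[OF x] Xc[OF y] Yc[OF a] Yc[OF c] by (simp add: assoc)
    also have "\<dots> = \<alpha> (x, y) \<cdot>\<^sub>m (Y (a \<otimes> ?c) * X (x \<otimes> y))"
      using a c x y Xc mult_smult_distrib[OF mult_carrier_mat[OF Yc[OF a] Yc[OF c]], of "X (x \<otimes> y)" n]
      by (simp add: Xm Ym)
    also have "\<dots> = \<alpha> (x, y) \<cdot>\<^sub>m X (a \<otimes> x \<otimes> (b \<otimes> y))"
      unfolding eq using a c x y by (simp add: Xl)
    finally show ?thesis using x y ac by (intro GL_smult_cancel[OF XGL n]) auto
  qed
  define \<beta> where "\<beta> = (\<lambda>(C, D)\<in>carrier (G Mod N) \<times> carrier (G Mod N). \<alpha> (rep C, rep D))"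
  have \<beta>: "\<beta> (N #> x, N #> y) = \<alpha> (x, y)" if x: "x \<in> carrier G" and y: "y \<in> carrier G" for x y
  proof -
    obtain a where a: "a \<in> N" "rep (N #> x) = a \<otimes> x" using rep[OF x] by (auto simp: mem_coset_iff)
    obtain b where b: "b \<in> N" "rep (N #> y) = b \<otimes> y" using rep[OF y] by (auto simp: mem_coset_iff)
    have "\<beta> (N #> x, N #> y) = \<alpha> (a \<otimes> x, b \<otimes> y)"
      using x y a b by (auto simp: \<beta>_def carrier_Mod)
    then show ?thesis using \<alpha>inv[OF a(1) b(1) x y] by simp
  qed
  have \<beta>Z: "\<beta> \<in> carrier (Z2 (G Mod N))"
  proof -
    have "\<beta> \<in> carrier (G Mod N) \<times> carrier (G Mod N) \<rightarrow>\<^sub>E - {0}"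
      using \<alpha>nz \<beta> by (auto simp: PiE_iff carrier_Mod) (auto simp: \<beta>_def carrier_Mod)
    moreover have "\<alpha> (x, y) * \<alpha> (x \<otimes> y, z) = \<alpha> (x, y \<otimes> z) * \<alpha> (y, z)"
      if "x \<in> carrier G" "y \<in> carrier G" "z \<in> carrier G" for x y z
      using projective_cocycle[OF n _ is_group Xm that] XGL by auto
    ultimately show ?thesis by (auto simp: Z2_def carrier_Mod rcos_sum \<beta>)
  qed
  have "projective_representation G n (inflation G N \<beta>) X"
    unfolding projective_representation_def
    using n XGL inflation_in_Z2[OF \<beta>Z] Xm \<beta> by (auto simp: inflation_apply)
  moreover have "representation K n X" using Y by (simp add: representation_def hom_def XN Pi_iff)
  moreover have "affords K X \<theta>" using aff by (simp add: affords_def XN)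
  moreover have "X (g \<otimes> a) = X g * X a" if g: "g \<in> carrier G" and a: "a \<in> N" for g a
  proof -
    have "g \<otimes> a = g \<otimes> a \<otimes> inv g \<otimes> g" using g a by (simp add: m_assoc)
    then have "X (g \<otimes> a) = Y (g \<otimes> a \<otimes> inv g) * X g" using Xl[OF conj_mem[OF g a] g] by simp
    then show ?thesis using Xconj[OF g a] a by (simp add: XN)
  qed
  ultimately have "associated_projective_representation G N \<theta> n (inflation G N \<beta>) X"
    unfolding associated_projective_representation_def using Xl XN by auto
  then show ?thesis using \<beta>Z by blast
qed

end

section \<open>Comparison of factor sets\<close>

text \<open>The factor set lives on cosets from the start. With
  \<open>X \<one> = 1\<^sub>m n\<close> this forces \<beta> to be 1 when an argument is N, so
  compatibility with N on both sides is derived and not assumed.\<close>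

locale coset_projective = normal N G
  for G :: "('a, 'b) monoid_scheme" (structure) and N :: "'a set" +
  fixes n :: nat and X :: "'a \<Rightarrow> complex mat" and \<beta> :: "'a set \<times> 'a set \<Rightarrow> complex"
  assumes degree_pos: "n > 0"
    and X_GL: "g \<in> carrier G \<Longrightarrow> X g \<in> carrier (GL n)"
    and X_mult: "\<lbrakk>x \<in> carrier G; y \<in> carrier G\<rbrakk> \<Longrightarrow> X x * X y = \<beta> (N #> x, N #> y) \<cdot>\<^sub>m X (x \<otimes> y)"
    and X_one: "X \<one> = 1\<^sub>m n"
    and factor_Z2: "\<beta> \<in> carrier (Z2 (G Mod N))"
begin

lemma X_carrier [simp]: "g \<in> carrier G \<Longrightarrow> X g \<in> carrier_mat n n"
  using X_GL by (rule GL_carrier_mat)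

lemma X_smult_cancel: "g \<in> carrier G \<Longrightarrow> c \<cdot>\<^sub>m X g = d \<cdot>\<^sub>m X g \<Longrightarrow> c = d"
  using GL_smult_cancel[OF X_GL degree_pos] .

lemma factor_nonzero: "x \<in> carrier G \<Longrightarrow> y \<in> carrier G \<Longrightarrow> \<beta> (N #> x, N #> y) \<noteq> 0"
  using Z2_memD[OF factor_Z2] by (auto simp: carrier_Mod)

lemma factor_left_one: "y \<in> carrier G \<Longrightarrow> \<beta> (N, N #> y) = 1"
  using X_mult[of \<one> y] X_smult_cancel[of y "\<beta> (N, N #> y)" 1] subset
  by (simp add: X_one one_smult_mat left_mult_one_mat[OF X_carrier] coset_of_mem)

lemma factor_right_one: "x \<in> carrier G \<Longrightarrow> \<beta> (N #> x, N) = 1"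
  using X_mult[of x \<one>] X_smult_cancel[of x "\<beta> (N #> x, N)" 1] subset
  by (simp add: X_one one_smult_mat right_mult_one_mat[OF X_carrier] coset_of_mem)

lemma X_left: "a \<in> N \<Longrightarrow> g \<in> carrier G \<Longrightarrow> X (a \<otimes> g) = X a * X g"
  by (simp add: X_mult coset_of_mem factor_left_one one_smult_mat)

lemma X_right: "a \<in> N \<Longrightarrow> g \<in> carrier G \<Longrightarrow> X (g \<otimes> a) = X g * X a"
  by (simp add: X_mult coset_of_mem factor_right_one one_smult_mat)

lemma representation_N: "representation (G\<lparr>carrier := N\<rparr>) n X"
  using degree_pos X_GL X_left by (auto simp: representation_def hom_def)

lemma X_conj:
  assumes "g \<in> carrier G" "a \<in> N"
  shows "X g * X a = X (g \<otimes> a \<otimes> inv g) * X g"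
proof -
  have "X (g \<otimes> a \<otimes> inv g) * X g = X (g \<otimes> a \<otimes> inv g \<otimes> g)"
    using assms X_left inv_op_closed2 by simp
  also have "g \<otimes> a \<otimes> inv g \<otimes> g = g \<otimes> a" using assms by (simp add: m_assoc)
  finally show ?thesis using assms X_right by simp
qed

end

locale triple_projective = character_triple G N \<theta> + coset_projective G N n X \<beta>
  for G :: "('a, 'b) monoid_scheme" (structure) and N \<theta> n X \<beta> +
  assumes X_affords: "affords (G\<lparr>carrier := N\<rparr>) X \<theta>"

lemma (in character_triple) associated_imp_triple_projective:
  assumes "associated_projective_representation G N \<theta> n (inflation G N \<beta>) X" "\<beta> \<in> carrier (Z2 (G Mod N))"
  shows "triple_projective G N \<theta> n X \<beta>"
proof (intro triple_projective.intro coset_projective.intro)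
  show "character_triple G N \<theta>" "normal N G" by unfold_locales
  show "coset_projective_axioms G N n X \<beta>"
    using assms group.representation_one[OF group_K, of n X]
    by unfold_locales
      (auto simp: associated_projective_representation_def projective_representation_def inflation_apply)
  show "triple_projective_axioms G N \<theta> X"
    using assms by unfold_locales (simp add: associated_projective_representation_def)
qed

context triple_projective
begin

lemma proportional_factor:
  assumes H: "subgroup H G" "N \<subseteq> H" and W: "W \<in> H \<rightarrow> carrier (GL n)"
    and WN: "\<And>a. a \<in> N \<Longrightarrow> W a = X a"
    and Wl: "\<And>a h. a \<in> N \<Longrightarrow> h \<in> H \<Longrightarrow> W (a \<otimes> h) = W a * W h"
    and Wr: "\<And>a h. a \<in> N \<Longrightarrow> h \<in> H \<Longrightarrow> W (h \<otimes> a) = W h * W a"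
    and Wm: "\<And>x y. x \<in> H \<Longrightarrow> y \<in> H \<Longrightarrow> W x * W y = \<gamma> (x, y) \<cdot>\<^sub>m W (x \<otimes> y)"
  shows "\<exists>\<mu>. (\<forall>h\<in>H. \<mu> (N #> h) \<noteq> 0) \<and>
    (\<forall>x\<in>H. \<forall>y\<in>H. \<beta> (N #> x, N #> y) * (\<mu> (N #> x) * \<mu> (N #> y)) = \<gamma> (x, y) * \<mu> (N #> (x \<otimes> y)))"
proof -
  interpret K: group K by (rule group_K)
  interpret H: subgroup H G by (rule H)
  have Wc: "W h \<in> carrier_mat n n" if "h \<in> H" for h using W that by (auto intro: GL_carrier_mat)
  have "\<exists>c. c \<noteq> 0 \<and> W h = c \<cdot>\<^sub>m X h" if h: "h \<in> H" for h
  proof (rule K.affords_proportional[OF finite_N irreducible representation_N X_affords])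
    show "W h \<in> carrier (GL n)" "X h \<in> carrier (GL n)" using W h X_GL by auto
    fix a assume "a \<in> carrier K" then have a: "a \<in> N" by simp
    have c: "h \<otimes> a \<otimes> inv h \<in> N" using conj_mem h a by simp
    then show "X (h \<otimes> a \<otimes> inv h) \<in> carrier_mat n n" by simp
    show "X h * X a = X (h \<otimes> a \<otimes> inv h) * X h" using X_conj h a by simp
    have "X (h \<otimes> a \<otimes> inv h) * W h = W (h \<otimes> a \<otimes> inv h \<otimes> h)" using Wl[OF c h] WN[OF c] by simp
    also have "h \<otimes> a \<otimes> inv h \<otimes> h = h \<otimes> a" using h a by (simp add: m_assoc)
    finally show "W h * X a = X (h \<otimes> a \<otimes> inv h) * W h" using Wr[OF a h] WN[OF a] by simp
  qed
  then obtain c where c: "\<And>h. h \<in> H \<Longrightarrow> c h \<noteq> 0" "\<And>h. h \<in> H \<Longrightarrow> W h = c h \<cdot>\<^sub>m X h" by metis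
  have cinv: "c (a \<otimes> h) = c h" if a: "a \<in> N" and h: "h \<in> H" for a h
  proof -
    have ah: "a \<otimes> h \<in> H" using a h H(2) by auto
    have "c (a \<otimes> h) \<cdot>\<^sub>m X (a \<otimes> h) = c h \<cdot>\<^sub>m X (a \<otimes> h)"
      using c(2)[OF ah, symmetric] Wl[OF a h] c(2)[OF h] WN[OF a] X_left[OF a] h a
      by (simp add: mult_smult_distrib[of _ n n _ n])
    then show ?thesis using ah by (intro X_smult_cancel[of "a \<otimes> h"]) auto
  qed
  define \<mu> where "\<mu> C = c (SOME h. h \<in> C)" for C :: "'a set"
  have \<mu>: "\<mu> (N #> h) = c h" if h: "h \<in> H" for h
  proof -
    have "(SOME x. x \<in> N #> h) \<in> N #> h" using rcos_self[OF _ subgroup_axioms, of h] h by (auto intro: someI)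
    then show ?thesis using cinv h by (auto simp: \<mu>_def mem_coset_iff)
  qed
  have "\<beta> (N #> x, N #> y) * (c x * c y) = \<gamma> (x, y) * c (x \<otimes> y)" if x: "x \<in> H" and y: "y \<in> H" for x y
  proof -
    have "(\<gamma> (x, y) * c (x \<otimes> y)) \<cdot>\<^sub>m X (x \<otimes> y) = W x * W y"
      using x y by (simp add: Wm c(2)[OF H.m_closed[OF x y]] smult_smult_mat)
    also have "\<dots> = (\<beta> (N #> x, N #> y) * (c x * c y)) \<cdot>\<^sub>m X (x \<otimes> y)"
      using x y by (simp add: c(2) mult_smult_distrib[of _ n n _ n] mult_smult_assoc_mat[of _ n n _ n]
          X_mult smult_smult_mat mult_ac)
    finally show ?thesis using x y by (intro X_smult_cancel[of "x \<otimes> y", symmetric]) auto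
  qed
  then show ?thesis using c(1) \<mu> by (intro exI[of _ \<mu>]) simp
qed

text \<open>Equality of characters on N supplies an intertwiner; conjugating \<open>Y\<close> by it
  makes the two agree on N and leaves the factor set \<gamma> unchanged.\<close>

lemma factor_comparison:
  assumes H: "subgroup H G" "N \<subseteq> H" and Y: "Y \<in> H \<rightarrow> carrier (GL m)"
    and YN: "representation K m Y" "affords K Y \<theta>"
    and Yl: "\<And>a h. a \<in> N \<Longrightarrow> h \<in> H \<Longrightarrow> Y (a \<otimes> h) = Y a * Y h"
    and Yr: "\<And>a h. a \<in> N \<Longrightarrow> h \<in> H \<Longrightarrow> Y (h \<otimes> a) = Y h * Y a"
    and Ym: "\<And>x y. x \<in> H \<Longrightarrow> y \<in> H \<Longrightarrow> Y x * Y y = \<gamma> (x, y) \<cdot>\<^sub>m Y (x \<otimes> y)"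
  shows "\<exists>\<mu>. (\<forall>h\<in>H. \<mu> (N #> h) \<noteq> 0) \<and>
    (\<forall>x\<in>H. \<forall>y\<in>H. \<beta> (N #> x, N #> y) * (\<mu> (N #> x) * \<mu> (N #> y)) = \<gamma> (x, y) * \<mu> (N #> (x \<otimes> y)))"
proof -
  interpret K: group K by (rule group_K)
  interpret H: subgroup H G by (rule H)
  note assoc = assoc_mult_mat[of _ n n _ n _ n]
  have mn: "m = n" and "\<exists>T\<in>carrier (GL n). \<forall>a\<in>N. Y a * T = T * X a"
    using K.affords_similar[OF finite_N irreducible YN representation_N X_affords] by auto
  then obtain T where T: "T \<in> carrier (GL n)" "\<And>a. a \<in> N \<Longrightarrow> Y a * T = T * X a" by blast
  note Y = Y[unfolded mn]
  let ?T = "inv\<^bsub>GL n\<^esub> T"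
  note car = GL_carrier_mat[OF T(1)] GL_inv(2)[OF T(1)]
  have Yc: "Y h \<in> carrier_mat n n" if "h \<in> H" for h using Y that by (auto intro: GL_carrier_mat)
  define W where "W h = ?T * Y h * T" for h
  have WGL: "W \<in> H \<rightarrow> carrier (GL n)"
    using Y T(1) GL_inv(1)[OF T(1)] by (auto simp: W_def intro!: GL_mult_closed)
  have prod: "W x * W y = ?T * (Y x * Y y) * T" if "x \<in> H" "y \<in> H" for x y
    using Yc[OF that(1)] Yc[OF that(2)] car GL_inv_cancel(1)[OF T(1), of "Y y * T" n]
    by (simp add: W_def assoc)
  show ?thesis
  proof (rule proportional_factor[OF H WGL])
    fix a assume a: "a \<in> N"
    have aH: "a \<in> H" using a H(2) by auto
    show "W a = X a"
      using T(2)[OF a] GL_inv_cancel(2)[OF T(1), of "X a" n] car Yc[OF aH] a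
      by (simp add: W_def assoc)
    fix h assume h: "h \<in> H"
    show "W (a \<otimes> h) = W a * W h" using prod[OF aH h] Yl[OF a h] by (simp add: W_def)
    show "W (h \<otimes> a) = W h * W a" using prod[OF h aH] Yr[OF a h] by (simp add: W_def)
  next
    fix x y assume xy: "x \<in> H" "y \<in> H"
    have "Y (x \<otimes> y) \<in> carrier_mat n n" using Yc xy by simp
    then show "W x * W y = \<gamma> (x, y) \<cdot>\<^sub>m W (x \<otimes> y)"
      using prod[OF xy] Ym[OF xy] car
      by (simp add: W_def mult_smult_distrib[of _ n n _ n] mult_smult_assoc_mat[of "?T * Y (x \<otimes> y)" n n _ n])
  qed
qed

text \<open>A representation affording the extension has factor set 1, so the comparison exhibits
  \<beta> on H/N as a coboundary, split by the inverse of the comparing function.\<close>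

lemma extends_imp_splits:
  assumes H: "subgroup H G" "N \<subseteq> H" and "extends_to G N \<theta> H"
  shows "\<exists>\<mu>. splits (G\<lparr>carrier := H\<rparr> Mod N) \<beta> \<mu>"
proof -
  obtain \<chi> m Y where Y: "representation (G\<lparr>carrier := H\<rparr>) m Y" "affords (G\<lparr>carrier := H\<rparr>) Y \<chi>"
    and \<chi>: "\<And>a. a \<in> N \<Longrightarrow> \<chi> a = \<theta> a"
    using assms(3) by (auto simp: extends_to_def is_extension_def is_character_def)
  have mult: "Y (x \<otimes> y) = Y x * Y y" if "x \<in> H" "y \<in> H" for x y
    using representation_mult[OF Y(1)] that by simp
  have "\<exists>\<mu>. (\<forall>h\<in>H. \<mu> (N #> h) \<noteq> 0) \<and> (\<forall>x\<in>H. \<forall>y\<in>H.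
      \<beta> (N #> x, N #> y) * (\<mu> (N #> x) * \<mu> (N #> y)) = (\<lambda>_. 1) (x, y) * \<mu> (N #> (x \<otimes> y)))"
  proof (rule factor_comparison[OF H])
    show "Y \<in> H \<rightarrow> carrier (GL m)" using representation_GL[OF Y(1)] by auto
    show "representation K m Y" using Y(1) H(2) by (auto simp: representation_def hom_def)
    show "affords K Y \<theta>" using Y(2) \<chi>[symmetric] H(2) by (auto simp: affords_def)
  qed (use H(2) mult in \<open>auto simp: one_smult_mat\<close>)
  then obtain \<mu> where \<mu>: "\<And>h. h \<in> H \<Longrightarrow> \<mu> (N #> h) \<noteq> 0"
    "\<And>x y. x \<in> H \<Longrightarrow> y \<in> H \<Longrightarrow> \<beta> (N #> x, N #> y) * (\<mu> (N #> x) * \<mu> (N #> y)) = \<mu> (N #> (x \<otimes> y))"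
    by auto
  have "\<beta> (N #> x, N #> y) * inverse (\<mu> (N #> (x \<otimes> y))) = inverse (\<mu> (N #> x)) * inverse (\<mu> (N #> y))"
    if "x \<in> H" "y \<in> H" for x y
    using \<mu>(1)[OF that(1)] \<mu>(1)[OF that(2)] \<mu>(1)[OF subgroup.m_closed[OF H(1) that]] \<mu>(2)[OF that]
    by (simp add: field_simps)
  then have "splits (G\<lparr>carrier := H\<rparr> Mod N) \<beta> (\<lambda>C. inverse (\<mu> C))"
    using \<mu>(1) subgroup.mem_carrier[OF H(1)]
    by (auto simp: splits_def carrier_subgroup_Mod mult_subgroup_Mod rcos_sum simp del: mult_FactGroup)
       (auto simp: rcos_sum)
  then show ?thesis by blast
qed

text \<open>The comparison over the whole of G: the factor sets differ by the coboundary of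
  \<mu>.\<close>

lemma cohomology_class_unique:
  assumes "triple_projective G N \<theta> m Y \<gamma>"
  shows "cohomology_class (G Mod N) \<gamma> = cohomology_class (G Mod N) \<beta>"
proof -
  interpret Y: triple_projective G N \<theta> m Y \<gamma> by (rule assms)
  interpret Q: group "G Mod N" by (rule factorgroup_is_group)
  interpret Z: comm_group "Z2 (G Mod N)" by (rule Q.comm_group_Z2)
  have "\<exists>\<mu>. (\<forall>h\<in>carrier G. \<mu> (N #> h) \<noteq> 0) \<and> (\<forall>x\<in>carrier G. \<forall>y\<in>carrier G.
      \<beta> (N #> x, N #> y) * (\<mu> (N #> x) * \<mu> (N #> y)) = (\<lambda>(x, y). \<gamma> (N #> x, N #> y)) (x, y) * \<mu> (N #> (x \<otimes> y)))"
    by (rule factor_comparison[OF subgroup_self subset])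
      (use Y.X_GL Y.representation_N Y.X_affords Y.X_left Y.X_right Y.X_mult in auto)
  then obtain \<mu> where \<mu>: "\<And>h. h \<in> carrier G \<Longrightarrow> \<mu> (N #> h) \<noteq> 0"
    "\<And>x y. x \<in> carrier G \<Longrightarrow> y \<in> carrier G \<Longrightarrow>
      \<beta> (N #> x, N #> y) * (\<mu> (N #> x) * \<mu> (N #> y)) = \<gamma> (N #> x, N #> y) * \<mu> (N #> (x \<otimes> y))"
    by auto
  let ?d = "coboundary (G Mod N) \<mu>"
  have d: "?d \<in> B2 (G Mod N)" using \<mu>(1) by (auto simp: B2_def carrier_Mod)
  have "\<gamma> = ?d \<otimes>\<^bsub>Z2 (G Mod N)\<^esub> \<beta>"
  proof (rule ext)
    fix t
    show "\<gamma> t = (?d \<otimes>\<^bsub>Z2 (G Mod N)\<^esub> \<beta>) t"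
    proof (cases "t \<in> carrier (G Mod N) \<times> carrier (G Mod N)")
      case True
      then obtain x y where xy: "x \<in> carrier G" "y \<in> carrier G" "t = (N #> x, N #> y)"
        by (auto simp: carrier_Mod)
      have "(?d \<otimes>\<^bsub>Z2 (G Mod N)\<^esub> \<beta>) t = \<mu> (N #> x) * \<mu> (N #> y) / \<mu> (N #> (x \<otimes> y)) * \<beta> (N #> x, N #> y)"
        using True xy by (simp add: Z2_def coboundary_def rcos_sum)
      then show ?thesis using \<mu>(2)[OF xy(1,2)] \<mu>(1)[of "x \<otimes> y"] xy by (simp add: field_simps)
    next
      case False
      then show ?thesis using Y.factor_Z2 by (cases t) (auto simp: Z2_def PiE_iff extensional_def)
    qed
  qed
  then have "\<gamma> \<in> B2 (G Mod N) #>\<^bsub>Z2 (G Mod N)\<^esub> \<beta>" using d by (auto simp: r_coset_def)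
  then show ?thesis
    unfolding cohomology_class_def
    using Z.repr_independence[OF _ factor_Z2 normal.axioms(1)[OF Q.B2_normal]] by simp
qed

lemma cohomology_element_eq: "cohomology_element G N \<theta> = cohomology_class (G Mod N) \<beta>"
  unfolding cohomology_element_def
proof (rule the_equality)
  have "associated_projective_representation G N \<theta> n (inflation G N \<beta>) X"
    using degree_pos X_GL X_mult X_left X_right inflation_in_Z2[OF factor_Z2] representation_N X_affords
    by (auto simp: associated_projective_representation_def projective_representation_def inflation_apply)
  then show "\<exists>n X \<alpha> \<beta>'. associated_projective_representation G N \<theta> n \<alpha> X \<and>
      \<beta>' \<in> carrier (Z2 (G Mod N)) \<and> \<alpha> = inflation G N \<beta>' \<and>
      cohomology_class (G Mod N) \<beta> = cohomology_class (G Mod N) \<beta>'"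
    using factor_Z2 by blast
next
  fix c assume "\<exists>n X \<alpha> \<beta>. associated_projective_representation G N \<theta> n \<alpha> X \<and>
      \<beta> \<in> carrier (Z2 (G Mod N)) \<and> \<alpha> = inflation G N \<beta> \<and> c = cohomology_class (G Mod N) \<beta>"
  then show "c = cohomology_class (G Mod N) \<beta>"
    using cohomology_class_unique associated_imp_triple_projective by blast
qed

end

section \<open>Roots of unity and the class function\<close>

lemma ex_complex_root:
  fixes z :: complex
  assumes "z \<noteq> 0" "m > 0"
  shows "\<exists>w. w ^ m = z"
proof -
  have "card {w. w ^ m = z} \<noteq> 0" using card_nth_roots[OF assms] assms(2) by simp
  then show ?thesis by (metis (mono_tags, lifting) card.empty empty_Collect_eq)
qed

text \<open>With k e = m q + 1, an m-th root of unity is the e-th power of its own k-th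
  power.\<close>

lemma root_of_unity_eqI:
  fixes z w :: "'a :: field"
  assumes "z ^ m = 1" "w ^ m = 1" "z ^ k = w ^ k" "coprime k m"
  shows "z = w"
proof (cases "k = 0")
  \<comment> \<open>Coprimality of 0 and m means m = 1, so both roots are 1.\<close>
  case True
  then show ?thesis using assms by simp
next
  case False
  then obtain e q where eq: "k * e = m * q + 1"
    using bezout_nat[of k m] assms(4) by auto
  have "z = z ^ (k * e)" "w = w ^ (k * e)"
    unfolding eq using assms by (simp_all add: power_mult)
  then show ?thesis using assms(3) by (simp add: power_mult)
qed

lemma (in group) conj_nat_pow:
  assumes "x \<in> carrier G" "g \<in> carrier G"
  shows "(x \<otimes> g \<otimes> inv x) [^] (k::nat) = x \<otimes> g [^] k \<otimes> inv x"
proof (induction k)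
  case (Suc k)
  then show ?case using assms by (simp add: m_assoc inv_mult_cancel)
qed (use assms in simp)

lemma GL_pow_closed: "A \<in> carrier (GL n) \<Longrightarrow> A [^]\<^bsub>GL n\<^esub> (k::nat) \<in> carrier (GL n)"
  using monoid.nat_pow_closed[OF group.is_monoid[OF group_GL]] .

lemma GL_pow_Suc: "A [^]\<^bsub>GL n\<^esub> (Suc k) = A [^]\<^bsub>GL n\<^esub> k * A"
  by (simp add: nat_pow_def)

lemma GL_smult_pow:
  assumes "A \<in> carrier (GL n)"
  shows "(c \<cdot>\<^sub>m A) [^]\<^bsub>GL n\<^esub> (k::nat) = c ^ k \<cdot>\<^sub>m (A [^]\<^bsub>GL n\<^esub> k)"
proof (induction k)
  case 0
  show ?case by (simp add: nat_pow_def one_smult_mat)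
next
  case (Suc k)
  show ?case
    unfolding GL_pow_Suc Suc
    using GL_carrier_mat[OF assms] GL_carrier_mat[OF GL_pow_closed[OF assms, of k]]
    by (simp add: mult_smult_distrib[of _ n n _ n] mult_smult_assoc_mat[of _ n n _ n] smult_smult_mat mult.commute)
qed

lemma pi_numbers_coprime:
  assumes "pi_number \<pi> m" "pi_number (prime_complement \<pi>) k"
  shows "coprime k m"
proof (rule ccontr)
  assume "\<not> coprime k m"
  then obtain p where "Factorial_Ring.prime p" "p dvd gcd k m"
    using prime_factor_nat[of "gcd k m"] by (auto simp: coprime_iff_gcd_eq_1)
  then show False using assms by (auto simp: pi_number_def prime_complement_def)
qed

section \<open>Preimages of subgroups of the quotient and Sylow subgroups\<close>

context normal
begin

lemma subgroup_of_Mod: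
  assumes S: "subgroup S (G Mod H)"
  defines "P \<equiv> {g \<in> carrier G. H #> g \<in> S}"
  shows "subgroup P G" "H \<subseteq> P" "carrier (G\<lparr>carrier := P\<rparr> Mod H) = S"
proof -
  interpret Q: group "G Mod H" by (rule factorgroup_is_group)
  interpret S: subgroup S "G Mod H" by (rule S)
  show "subgroup P G"
  proof (rule subgroupI)
    have "H #> \<one> \<in> S" using S.one_closed by (simp add: coset_of_mem)
    then show "P \<noteq> {}" by (auto simp: P_def)
    fix g assume g: "g \<in> P"
    have "inv\<^bsub>G Mod H\<^esub> (H #> g) \<in> S" using g S.m_inv_closed by (auto simp: P_def)
    moreover have "inv\<^bsub>G Mod H\<^esub> (H #> g) = H #> inv g"
      using g by (intro Q.inv_equality) (auto simp: P_def carrier_Mod rcos_sum coset_of_mem)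
    ultimately show "inv g \<in> P" using g by (simp add: P_def)
    fix h assume h: "h \<in> P"
    show "g \<otimes> h \<in> P" using g h S.m_closed[of "H #> g" "H #> h"] by (auto simp: P_def rcos_sum)
  qed (auto simp: P_def)
  show "H \<subseteq> P" using S.one_closed subset by (auto simp: P_def coset_of_mem)
  show "carrier (G\<lparr>carrier := P\<rparr> Mod H) = S"
    using S.subset by (auto simp: carrier_subgroup_Mod carrier_Mod P_def)
qed

lemma group_subgroup_Mod:
  assumes "subgroup K G" "H \<subseteq> K"
  shows "group (G\<lparr>carrier := K\<rparr> Mod H)"
  using normal.factorgroup_is_group[OF normal_restrict_supergroup[OF assms(1) normal_axioms assms(2)]] .

lemma finite_Mod: "finite (carrier G) \<Longrightarrow> finite (carrier (G Mod H))"
  by (simp add: carrier_Mod)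

text \<open>Preimage of a Sylow subgroup of G/H. If p does not divide the order, the exponent is 0
  and P/H is trivial, which still counts as a group for the prime set {p}.\<close>

lemma ex_Sylow_Mod:
  assumes fin: "finite (carrier G)" and p: "Factorial_Ring.prime p"
  shows "\<exists>P. subgroup P G \<and> H \<subseteq> P \<and> carrier (G\<lparr>carrier := P\<rparr> Mod H) \<in> Syl p (G Mod H) \<and>
    pi_group {p} (G\<lparr>carrier := P\<rparr> Mod H)"
proof -
  interpret Q: group "G Mod H" by (rule factorgroup_is_group)
  let ?e = "Factorial_Ring.multiplicity p (Coset.order (G Mod H))"
  obtain m where "Coset.order (G Mod H) = p ^ ?e * m" using multiplicity_dvd by (blast elim: dvdE)
  then obtain S where S: "subgroup S (G Mod H)" "card S = p ^ ?e"
    using sylow_thm[OF p Q.is_group _ finite_Mod[OF fin]] by blast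
  define P where "P = {g \<in> carrier G. H #> g \<in> S}"
  note P = subgroup_of_Mod[OF S(1), folded P_def]
  have "pi_group {p} (G\<lparr>carrier := P\<rparr> Mod H)"
    using group_subgroup_Mod[OF P(1,2)] P(3) S(2) p prime_gt_0_nat[OF p]
    by (auto simp: pi_group_def pi_number_def Coset.order_def dest: prime_dvd_power primes_dvd_imp_eq)
  then show ?thesis using P S by (auto simp: Syl_def)
qed

end

section \<open>The order of the cohomology class\<close>

context triple_projective
begin

lemma ord_dvd_iff:
  "group.ord (H2 (G Mod N)) (cohomology_element G N \<theta>) dvd k \<longleftrightarrow> (\<exists>\<mu>. splits (G Mod N) (\<lambda>t. \<beta> t ^ k) \<mu>)"
  unfolding cohomology_element_eq
  by (rule group.ord_cohomology_class_dvd_iff[OF factorgroup_is_group factor_Z2])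

text \<open>Transfer from the trivial subgroup bounds the order by |G/N|, which rules out the value
  0 for infinite order.\<close>

lemma ord_pos: "group.ord (H2 (G Mod N)) (cohomology_element G N \<theta>) > 0"
proof -
  interpret Q: group "G Mod N" by (rule factorgroup_is_group)
  have "group.ord (H2 (G Mod N)) (cohomology_element G N \<theta>) dvd Coset.order (G Mod N)"
    unfolding ord_dvd_iff by (rule Q.splits_power_order[OF finite_Mod[OF finite_carrier] factor_Z2])
  moreover have "Coset.order (G Mod N) > 0" using Q.order_gt_0_iff_finite finite_Mod[OF finite_carrier] by simp
  ultimately show ?thesis by (metis dvd_0_left_iff gr0I)
qed

text \<open>Since \<beta> splits on P/N, the order divides the index of P/N. A factor p in that
  index would give |G/N| a higher power of p than its multiplicity allows.\<close>

lemma extends_to_Sylow_imp_not_dvd_ord: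
  assumes p: "Factorial_Ring.prime p" and P: "subgroup P G" "N \<subseteq> P"
    and Syl: "carrier (G\<lparr>carrier := P\<rparr> Mod N) \<in> Syl p (G Mod N)" and ext: "extends_to G N \<theta> P"
  shows "\<not> p dvd group.ord (H2 (G Mod N)) (cohomology_element G N \<theta>)"
proof
  assume dvd: "p dvd group.ord (H2 (G Mod N)) (cohomology_element G N \<theta>)"
  interpret Q: group "G Mod N" by (rule factorgroup_is_group)
  define S where "S = carrier (G\<lparr>carrier := P\<rparr> Mod N)"
  let ?e = "Factorial_Ring.multiplicity p (Coset.order (G Mod N))"
  have S: "subgroup S (G Mod N)" "card S = p ^ ?e" using Syl by (auto simp: Syl_def S_def)
  obtain \<mu> where "splits (G\<lparr>carrier := P\<rparr> Mod N) \<beta> \<mu>" using extends_imp_splits[OF P ext] by blast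
  then have "splits ((G Mod N)\<lparr>carrier := S\<rparr>) \<beta> \<mu>"
    by (simp add: splits_def S_def mult_subgroup_Mod del: mult_FactGroup)
  then have "group.ord (H2 (G Mod N)) (cohomology_element G N \<theta>) dvd card (rcosets\<^bsub>G Mod N\<^esub> S)"
    unfolding ord_dvd_iff by (rule Q.splits_power_index[OF finite_Mod[OF finite_carrier] factor_Z2 S(1)])
  with dvd have "p dvd card (rcosets\<^bsub>G Mod N\<^esub> S)" by (rule dvd_trans)
  then have "p ^ Suc ?e dvd card (rcosets\<^bsub>G Mod N\<^esub> S) * card S" using S(2) by (simp add: mult_dvd_mono)
  then have "p ^ Suc ?e dvd Coset.order (G Mod N)" using Q.lagrange[OF S(1)] by simp
  moreover have "Coset.order (G Mod N) \<noteq> 0" using Q.order_gt_0_iff_finite finite_Mod[OF finite_carrier] by simp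
  ultimately have "Suc ?e \<le> ?e"
    using p by (intro multiplicity_geI) auto
  then show False by simp
qed

text \<open>Dividing \<open>X\<close> by m-th roots of the values of \<mu> changes \<beta> by a
  coboundary whose m-th power cancels that of \<beta>.\<close>

lemma ex_root_of_unity_factor:
  assumes m: "m > 0" and \<mu>: "splits (G Mod N) (\<lambda>t. \<beta> t ^ m) \<mu>"
  shows "\<exists>X' \<beta>'. triple_projective G N \<theta> n X' \<beta>' \<and>
    (\<forall>x\<in>carrier G. \<forall>y\<in>carrier G. \<beta>' (N #> x, N #> y) ^ m = 1)"
proof -
  interpret Q: group "G Mod N" by (rule factorgroup_is_group)
  interpret Z: comm_group "Z2 (G Mod N)" by (rule Q.comm_group_Z2)
  have \<mu>nz: "\<mu> (N #> x) \<noteq> 0" if "x \<in> carrier G" for x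
    using \<mu> that by (auto simp: splits_def carrier_Mod)
  have \<mu>m: "\<beta> (N #> x, N #> y) ^ m * \<mu> (N #> (x \<otimes> y)) = \<mu> (N #> x) * \<mu> (N #> y)"
    if "x \<in> carrier G" "y \<in> carrier G" for x y
    using \<mu> that by (auto simp: splits_def carrier_Mod rcos_sum)
  have \<mu>N: "\<mu> N = 1"
    using \<mu>m[of \<one> \<one>] \<mu>nz[of \<one>] factor_left_one[of \<one>] by (simp add: coset_of_mem)
  \<comment> \<open>The root at the trivial coset must be 1 so that \<open>X\<close> keeps its
    values on N; this is consistent because \<mu> N = 1.\<close>
  define \<kappa> where "\<kappa> C = (if C = N then 1 else SOME w. w ^ m = \<mu> C)" for C
  have \<kappa>: "\<kappa> (N #> x) ^ m = \<mu> (N #> x)" if "x \<in> carrier G" for x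
    using ex_complex_root[OF \<mu>nz[OF that] m] \<mu>N by (auto simp: \<kappa>_def intro: someI_ex)
  have \<kappa>nz: "\<kappa> (N #> x) \<noteq> 0" if "x \<in> carrier G" for x
    using \<kappa>[OF that] \<mu>nz[OF that] m by (metis power_0_left less_numeral_extra(3))
  define \<nu> where "\<nu> C = inverse (\<kappa> C)" for C
  have \<nu>nz: "\<nu> (N #> x) \<noteq> 0" if "x \<in> carrier G" for x using \<kappa>nz[OF that] by (simp add: \<nu>_def)
  define X' where "X' g = \<nu> (N #> g) \<cdot>\<^sub>m X g" for g
  define \<beta>' where "\<beta>' = coboundary (G Mod N) \<nu> \<otimes>\<^bsub>Z2 (G Mod N)\<^esub> \<beta>"
  have \<beta>': "\<beta>' (N #> x, N #> y) = \<nu> (N #> x) * \<nu> (N #> y) / \<nu> (N #> (x \<otimes> y)) * \<beta> (N #> x, N #> y)"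
    if "x \<in> carrier G" "y \<in> carrier G" for x y
    using that by (auto simp: \<beta>'_def Z2_def coboundary_def carrier_Mod rcos_sum)
  have X'N: "X' a = X a" if "a \<in> N" for a
    using that by (simp add: X'_def coset_of_mem \<nu>_def \<kappa>_def one_smult_mat)
  have "coset_projective_axioms G N n X' \<beta>'"
  proof
    show "\<beta>' \<in> carrier (Z2 (G Mod N))"
      unfolding \<beta>'_def using \<nu>nz
      by (intro Z.m_closed factor_Z2 Q.coboundary_in_Z2) (auto simp: carrier_Mod)
    fix x y assume xy: "x \<in> carrier G" "y \<in> carrier G"
    show "X' x * X' y = \<beta>' (N #> x, N #> y) \<cdot>\<^sub>m X' (x \<otimes> y)"
      using xy \<nu>nz[of "x \<otimes> y"]
      by (simp add: X'_def \<beta>' mult_smult_distrib[of _ n n _ n] mult_smult_assoc_mat[of _ n n _ n]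
          X_mult smult_smult_mat mult_ac)
  next
    show "X' \<one> = 1\<^sub>m n" using X'N[of \<one>] X_one by simp
  qed (use degree_pos X_GL \<nu>nz in \<open>auto simp: X'_def intro: GL_smult\<close>)
  moreover have "triple_projective_axioms G N \<theta> X'"
    using X_affords by unfold_locales (simp add: affords_def X'N)
  ultimately have "triple_projective G N \<theta> n X' \<beta>'"
    by (intro triple_projective.intro coset_projective.intro character_triple_axioms normal_axioms)
  moreover have "\<beta>' (N #> x, N #> y) ^ m = 1" if "x \<in> carrier G" "y \<in> carrier G" for x y
  proof -
    have "\<beta>' (N #> x, N #> y) ^ m = \<beta> (N #> x, N #> y) ^ m * \<mu> (N #> (x \<otimes> y)) / (\<mu> (N #> x) * \<mu> (N #> y))"
      using that by (simp add: \<beta>' \<nu>_def power_mult_distrib power_divide power_inverse \<kappa> field_simps)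
    then show ?thesis using \<mu>m[OF that] \<mu>nz that by simp
  qed
  ultimately show ?thesis by blast
qed

end

section \<open>The class function determined by distinguished multiples of the matrices of
  \<open>X\<close>\<close>

locale root_of_unity_triple = triple_projective G N \<theta> n X \<beta>
  for G :: "('a, 'b) monoid_scheme" (structure) and N \<theta> n X \<beta> +
  fixes m :: nat
  assumes exponent_pos: "m > 0"
    and factor_root: "\<lbrakk>x \<in> carrier G; y \<in> carrier G\<rbrakk> \<Longrightarrow> \<beta> (N #> x, N #> y) ^ m = 1"
begin

text \<open>On a subgroup \<open>H\<close> with \<open>|H : N|\<close> prime to \<open>m\<close> there is an extension of \<open>X\<close> from \<open>N\<close> whose values
  are multiples of those of \<open>X\<close> by \<open>m\<close>-th roots of unity.  Its value at \<open>g\<close> satisfies this predicate,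
  which does not mention \<open>H\<close>.\<close>

definition lift :: "'a \<Rightarrow> complex mat \<Rightarrow> bool" where
  "lift g W \<longleftrightarrow> (\<exists>z. z ^ m = 1 \<and> W = z \<cdot>\<^sub>m X g) \<and>
     (\<exists>r::nat. coprime r m \<and> g [^] r \<in> N \<and> W [^]\<^bsub>GL n\<^esub> r = X (g [^] r))"

lemma X_pow: "a \<in> N \<Longrightarrow> X (a [^] (k::nat)) = X a [^]\<^bsub>GL n\<^esub> k"
proof (induction k)
  case 0
  show ?case using X_one by (simp add: nat_pow_def)
next
  case (Suc k)
  have "X (a [^] k \<otimes> a) = X (a [^] k) * X a"
    using Suc.prems by (intro X_right) auto
  then show ?case using Suc unfolding GL_pow_Suc by simp
qed

text \<open>The exponents r and s may come from different subgroups. Both matrices have the same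
  power of exponent r s, namely the value of \<open>X\<close> at that power of g, so the scalars
  agree after raising to r s, which is prime to m.\<close>

lemma lift_unique:
  assumes g: "g \<in> carrier G" and W: "lift g W" and V: "lift g V"
  shows "W = V"
proof -
  interpret GL: group "GL n" by (rule group_GL)
  obtain z r where z: "z ^ m = 1" "W = z \<cdot>\<^sub>m X g" and r: "coprime r m" "g [^] r \<in> N" "W [^]\<^bsub>GL n\<^esub> r = X (g [^] r)"
    using W by (auto simp: lift_def)
  obtain w s where w: "w ^ m = 1" "V = w \<cdot>\<^sub>m X g" and s: "coprime s m" "g [^] s \<in> N" "V [^]\<^bsub>GL n\<^esub> s = X (g [^] s)"
    using V by (auto simp: lift_def)
  have nz: "z \<noteq> 0" "w \<noteq> 0" using z w exponent_pos by (metis power_0_left less_numeral_extra(3) zero_neq_one)+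
  have car: "W \<in> carrier (GL n)" "V \<in> carrier (GL n)" using z w nz GL_smult[OF X_GL[OF g]] by auto
  have "W [^]\<^bsub>GL n\<^esub> (r * s) = X ((g [^] r) [^] s)"
    using X_pow[OF r(2)] r(3) GL.nat_pow_pow[OF car(1), of r s] by simp
  also have "\<dots> = X ((g [^] s) [^] r)" using g by (simp add: nat_pow_pow mult.commute)
  also have "\<dots> = V [^]\<^bsub>GL n\<^esub> (r * s)"
    using X_pow[OF s(2)] s(3) GL.nat_pow_pow[OF car(2), of s r] by (simp add: mult.commute)
  finally have "z ^ (r * s) = w ^ (r * s)"
    unfolding z w GL_smult_pow[OF X_GL[OF g]]
    by (rule GL_smult_cancel[OF GL_pow_closed[OF X_GL[OF g]] degree_pos])
  then have "z = w" using root_of_unity_eqI[OF z(1) w(1)] r(1) s(1) by simp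
  then show ?thesis using z w by simp
qed

text \<open>Conjugation by \<open>X x\<close> sends \<open>X g\<close> to a multiple of
  \<open>X\<close> at the conjugate element. The factor is a quotient of two values of \<beta>,
  hence an m-th root of unity. The power condition is carried along because on N conjugation by
  \<open>X x\<close> is exact.\<close>

lemma lift_conj:
  assumes g: "g \<in> carrier G" and x: "x \<in> carrier G" and W: "lift g W"
  shows "lift (x \<otimes> g \<otimes> inv x) (X x * W * inv\<^bsub>GL n\<^esub> (X x))"
proof -
  interpret GL: group "GL n" by (rule group_GL)
  let ?g = "x \<otimes> g \<otimes> inv x" and ?V = "inv\<^bsub>GL n\<^esub> (X x)"
  note assoc = assoc_mult_mat[of _ n n _ n _ n]
  note V = GL_inv[OF X_GL[OF x]]
  obtain z r where z: "z ^ m = 1" "W = z \<cdot>\<^sub>m X g" and r: "coprime r m" "g [^] r \<in> N" "W [^]\<^bsub>GL n\<^esub> r = X (g [^] r)"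
    using W by (auto simp: lift_def)
  have g': "?g \<in> carrier G" using g x by simp
  let ?b = "\<beta> (N #> x, N #> g)" and ?c = "\<beta> (N #> ?g, N #> x)"
  have b: "?b ^ m = 1" "?c ^ m = 1" "?c \<noteq> 0" using factor_root factor_nonzero x g g' by auto
  have "X x * X g = ?b \<cdot>\<^sub>m X (x \<otimes> g)" using X_mult x g by simp
  also have "x \<otimes> g = ?g \<otimes> x" using x g by (simp add: m_assoc)
  also have "X (?g \<otimes> x) = inverse ?c \<cdot>\<^sub>m (X ?g * X x)"
    unfolding X_mult[OF g' x] smult_smult_mat using b(3) by (simp add: one_smult_mat)
  finally have "X x * X g = (?b / ?c) \<cdot>\<^sub>m (X ?g * X x)"
    by (simp add: smult_smult_mat divide_inverse)
  then have "X x * X g * ?V = (?b / ?c) \<cdot>\<^sub>m (X ?g * X x) * ?V" by simp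
  also have "\<dots> = (?b / ?c) \<cdot>\<^sub>m X ?g"
    using X_carrier[OF g'] X_carrier[OF x] V
    by (simp add: mult_smult_assoc_mat[of _ n n _ n] assoc)
  finally have 1: "X x * X g * ?V = (?b / ?c) \<cdot>\<^sub>m X ?g" .
  have "X x * W * ?V = z \<cdot>\<^sub>m (X x * X g * ?V)"
    using X_carrier[OF g] X_carrier[OF x] V(2)
    by (simp add: z(2) mult_smult_distrib[of _ n n _ n] mult_smult_assoc_mat[of _ n n _ n] assoc)
  then have "X x * W * ?V = (z * (?b / ?c)) \<cdot>\<^sub>m X ?g" unfolding 1 by (simp add: smult_smult_mat)
  moreover have "(z * (?b / ?c)) ^ m = 1" using z b by (simp add: power_mult_distrib power_divide)
  moreover have pow: "?g [^] r = x \<otimes> g [^] r \<otimes> inv x" using conj_nat_pow[OF x g] .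
  moreover have "?g [^] r \<in> N" unfolding pow using conj_mem[OF x r(2)] .
  moreover have "(X x * W * ?V) [^]\<^bsub>GL n\<^esub> r = X (?g [^] r)"
  proof -
    have "z \<noteq> 0" using z exponent_pos by (metis power_0_left less_numeral_extra(3) zero_neq_one)
    then have WGL: "W \<in> carrier (GL n)" using z(2) GL_smult[OF X_GL[OF g]] by simp
    have "(X x * W * ?V) [^]\<^bsub>GL n\<^esub> r = X x * (W [^]\<^bsub>GL n\<^esub> r) * ?V"
      using GL.conj_nat_pow[OF X_GL[OF x] WGL, of r] by simp
    also have "\<dots> = X (?g [^] r) * X x * ?V"
      unfolding r(3) pow X_conj[OF x r(2)] ..
    also have "\<dots> = X (?g [^] r)"
      using V X_carrier[OF x] X_carrier[of "?g [^] r"] right_mult_one_mat[of "X (?g [^] r)" n n] g'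
      by (simp add: assoc)
    finally show ?thesis .
  qed
  ultimately show ?thesis using r(1) unfolding lift_def by metis
qed

text \<open>The default 0 is taken only at elements that lie in no subgroup H over N with |H/N|
  prime to m; any other default constant would serve equally well.\<close>

definition lift_char :: "'a \<Rightarrow> complex" where
  "lift_char g = (if \<exists>W. lift g W then mat_trace (THE W. lift g W) else 0)"

lemma lift_char_eq:
  assumes "g \<in> carrier G" "lift g W"
  shows "lift_char g = mat_trace W"
proof -
  have "(THE V. lift g V) = W" using assms lift_unique by (intro the_equality)
  moreover have "\<exists>V. lift g V" using assms(2) by (rule exI)
  ultimately show ?thesis by (simp add: lift_char_def)
qed

lemma class_function_lift_char: "class_function G lift_char"
  unfolding class_function_def
proof (intro ballI)
  fix x g assume x: "x \<in> carrier G" and g: "g \<in> carrier G"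
  let ?g = "x \<otimes> g \<otimes> inv x"
  have g': "?g \<in> carrier G" using x g by simp
  show "lift_char ?g = lift_char g"
  proof (cases "\<exists>W. lift g W")
    case True
    then obtain W where W: "lift g W" by blast
    have "W \<in> carrier_mat n n" using W g by (auto simp: lift_def)
    then have "mat_trace (X x * W * inv\<^bsub>GL n\<^esub> (X x)) = mat_trace W"
      using GL_inv[OF X_GL[OF x]] X_carrier[OF x] by (intro mat_trace_conj)
    then show ?thesis
      using lift_char_eq[OF g W] lift_char_eq[OF g' lift_conj[OF g x W]] by simp
  next
    case False
    \<comment> \<open>Conjugation by the inverse of x would bring such a matrix back to g, so the
      default value is constant on conjugacy classes.\<close>
    have "\<not> lift ?g V" for V
    proof
      assume "lift ?g V"
      from lift_conj[OF g' inv_closed[OF x] this]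
      show False using False x g by (auto simp: m_assoc inv_mult_cancel)
    qed
    then show ?thesis using False by (simp add: lift_char_def)
  qed
qed

text \<open>A splitting on H/N by m-th roots of unity rescales \<open>X\<close> to an ordinary
  representation of H. By uniqueness its matrices are the ones selected at each element, so its
  trace is the function defined without reference to H.\<close>

lemma lift_char_is_extension:
  assumes H: "subgroup H G" "N \<subseteq> H" and cop: "coprime (Coset.order (G\<lparr>carrier := H\<rparr> Mod N)) m"
  shows "is_extension G N \<theta> H lift_char"
proof -
  interpret H: subgroup H G by (rule H(1))
  interpret GL: group "GL n" by (rule group_GL)
  let ?T = "G\<lparr>carrier := H\<rparr> Mod N"
  let ?k = "Coset.order ?T"
  interpret T: group ?T by (rule group_subgroup_Mod[OF H])
  have fin: "finite (carrier ?T)"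
    using finite_subset[OF H.subset finite_carrier] by (simp add: carrier_subgroup_Mod)
  have "\<exists>\<mu>. splits ?T (restrict \<beta> (carrier ?T \<times> carrier ?T)) \<mu> \<and> (\<forall>C\<in>carrier ?T. \<mu> C ^ m = 1)"
    by (rule T.splits_root_of_unity[OF fin restrict_Z2_Mod[OF H(1) factor_Z2] _ cop])
      (auto simp: carrier_subgroup_Mod factor_root)
  then obtain \<mu> where \<mu>: "splits ?T (restrict \<beta> (carrier ?T \<times> carrier ?T)) \<mu>" and "\<forall>C\<in>carrier ?T. \<mu> C ^ m = 1"
    by blast
  then have \<mu>root: "\<mu> (N #> h) ^ m = 1" and \<mu>nz: "\<mu> (N #> h) \<noteq> 0" if "h \<in> H" for h
    using that by (auto simp: splits_def carrier_subgroup_Mod)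
  have \<mu>m: "\<beta> (N #> x, N #> y) * \<mu> (N #> (x \<otimes> y)) = \<mu> (N #> x) * \<mu> (N #> y)" if "x \<in> H" "y \<in> H" for x y
    using \<mu> that by (auto simp: splits_def carrier_subgroup_Mod mult_subgroup_Mod rcos_sum
        simp flip: mult_subgroup_Mod[of H])
  have \<mu>N: "\<mu> N = 1"
    using \<mu>m[of \<one> \<one>] \<mu>nz[of \<one>] factor_left_one[of \<one>] by (simp add: coset_of_mem)
  define Y where "Y h = inverse (\<mu> (N #> h)) \<cdot>\<^sub>m X h" for h
  have YGL: "Y h \<in> carrier (GL n)" if "h \<in> H" for h
    using that \<mu>nz X_GL by (auto simp: Y_def intro: GL_smult)
  have Ym: "Y (x \<otimes> y) = Y x * Y y" if "x \<in> H" "y \<in> H" for x y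
  proof -
    have "inverse (\<mu> (N #> (x \<otimes> y))) = inverse (\<mu> (N #> x)) * inverse (\<mu> (N #> y)) * \<beta> (N #> x, N #> y)"
      using \<mu>m[OF that] \<mu>nz[OF that(1)] \<mu>nz[OF that(2)] \<mu>nz[of "x \<otimes> y"] that by (simp add: field_simps)
    then show ?thesis
      using that by (simp add: Y_def mult_smult_distrib[of _ n n _ n] mult_smult_assoc_mat[of _ n n _ n]
          X_mult smult_smult_mat mult_ac)
  qed
  have YN: "Y a = X a" if "a \<in> N" for a
    using that by (simp add: Y_def coset_of_mem \<mu>N one_smult_mat)
  have Ypow: "Y h [^]\<^bsub>GL n\<^esub> (k::nat) = Y (h [^] k)" if h: "h \<in> H" for h k
  proof (induction k)
    case 0
    show ?case using YN[of \<one>] X_one by (simp add: nat_pow_def)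
  next
    case (Suc k)
    have "h [^] k \<in> H" using h by (induction k) auto
    then show ?case using Suc Ym h unfolding GL_pow_Suc by simp
  qed
  \<comment> \<open>The exponent is |H/N|: it is prime to m and sends h into N, where the rescaled
    representation equals \<open>X\<close>.\<close>
  have lift: "lift h (Y h)" if h: "h \<in> H" for h
  proof -
    have pow: "(N #> h) [^]\<^bsub>?T\<^esub> k = N #> (h [^] k)" for k :: nat
    proof (induction k)
      case 0
      show ?case by (simp add: nat_pow_def one_subgroup_Mod coset_of_mem)
    next
      case (Suc k)
      have "h [^] k \<in> H" using h by (induction k) auto
      then show ?case
        using Suc h by (simp add: mult_subgroup_Mod rcos_sum del: mult_FactGroup) (simp add: rcos_sum)
    qed
    have "(N #> h) [^]\<^bsub>?T\<^esub> ?k = \<one>\<^bsub>?T\<^esub>" using h by (intro T.pow_order_eq_1) (auto simp: carrier_subgroup_Mod)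
    then have "N #> (h [^] ?k) = N" unfolding pow by (simp add: one_subgroup_Mod)
    then have hk: "h [^] ?k \<in> N" using rcos_self[OF _ subgroup_axioms, of "h [^] ?k"] h by simp
    have "inverse (\<mu> (N #> h)) ^ m = 1" using \<mu>root[OF h] by (simp add: power_inverse)
    then show ?thesis
      unfolding lift_def using hk Ypow[OF h, of ?k] YN[OF hk] cop by (auto simp: Y_def)
  qed
  have "representation (G\<lparr>carrier := H\<rparr>) n Y"
    using degree_pos YGL Ym by (auto simp: representation_def hom_def)
  moreover have "affords (G\<lparr>carrier := H\<rparr>) Y lift_char"
    using lift_char_eq[OF _ lift] by (auto simp: affords_def)
  moreover have "lift_char a = \<theta> a" if a: "a \<in> N" for a
    using lift_char_eq[OF _ lift, of a] X_affords a H(2) by (auto simp: YN affords_def)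
  ultimately show ?thesis unfolding is_extension_def is_character_def by blast
qed

end

theorem theoremA:
  fixes G :: "('a, 'b) monoid_scheme" (structure)
    and N :: "'a set" and \<theta> :: "'a \<Rightarrow> complex" and \<pi> :: "nat set"
  assumes triple: "character_triple G N \<theta>"
    and primes: "\<forall>p\<in>\<pi>. Factorial_Ring.prime p"
  shows
    "(pi_number \<pi> (group.ord (H2 (G Mod N)) (cohomology_element G N \<theta>))
        \<longleftrightarrow>
      (\<forall>p. Factorial_Ring.prime p \<and> p \<notin> \<pi> \<longrightarrow>
        (\<exists>P. subgroup P G \<and> N \<subseteq> P \<and> carrier (G\<lparr>carrier := P\<rparr> Mod N) \<in> Syl p (G Mod N) \<and>
             extends_to G N \<theta> P)))
     \<and>
     ((\<forall>p. Factorial_Ring.prime p \<and> p \<notin> \<pi> \<longrightarrow>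
        (\<exists>P. subgroup P G \<and> N \<subseteq> P \<and> carrier (G\<lparr>carrier := P\<rparr> Mod N) \<in> Syl p (G Mod N) \<and>
             extends_to G N \<theta> P))
        \<longleftrightarrow>
      (\<exists>\<theta>'. class_function G \<theta>' \<and>
        (\<forall>H. subgroup H G \<and> N \<subseteq> H \<and>
             pi_group (prime_complement \<pi>) (G\<lparr>carrier := H\<rparr> Mod N) \<longrightarrow>
             is_extension G N \<theta> H \<theta>')))"
    (is "(?a \<longleftrightarrow> ?b) \<and> (?b \<longleftrightarrow> ?c)")
proof -
  interpret character_triple G N \<theta> by (rule triple)
  obtain n X \<beta> where X: "triple_projective G N \<theta> n X \<beta>"
    using ex_associated associated_imp_triple_projective by blast
  interpret triple_projective G N \<theta> n X \<beta> by (rule X)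
  let ?m = "group.ord (H2 (G Mod N)) (cohomology_element G N \<theta>)"
  have ac: ?c if a: ?a
  proof -
    obtain \<mu> where "splits (G Mod N) (\<lambda>t. \<beta> t ^ ?m) \<mu>" using ord_dvd_iff[of ?m] by auto
    from ex_root_of_unity_factor[OF ord_pos this]
    obtain X' \<beta>' where X': "triple_projective G N \<theta> n X' \<beta>'"
      and root: "\<And>x y. x \<in> carrier G \<Longrightarrow> y \<in> carrier G \<Longrightarrow> \<beta>' (N #> x, N #> y) ^ ?m = 1" by blast
    interpret L: root_of_unity_triple G N \<theta> n X' \<beta>' ?m
      using X' root ord_pos by (intro root_of_unity_triple.intro root_of_unity_triple_axioms.intro)
    have "is_extension G N \<theta> H L.lift_char"
      if "subgroup H G" "N \<subseteq> H" "pi_group (prime_complement \<pi>) (G\<lparr>carrier := H\<rparr> Mod N)" for H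
      using that pi_numbers_coprime[OF a] by (intro L.lift_char_is_extension) (auto simp: pi_group_def)
    then show ?thesis using L.class_function_lift_char by blast
  qed
  have cb: ?b if c: ?c
  proof (intro allI impI)
    obtain \<theta>' where \<theta>': "\<And>H. subgroup H G \<Longrightarrow> N \<subseteq> H \<Longrightarrow>
        pi_group (prime_complement \<pi>) (G\<lparr>carrier := H\<rparr> Mod N) \<Longrightarrow> is_extension G N \<theta> H \<theta>'"
      using c by blast
    fix p assume p: "Factorial_Ring.prime p \<and> p \<notin> \<pi>"
    then obtain P where P: "subgroup P G" "N \<subseteq> P" "carrier (G\<lparr>carrier := P\<rparr> Mod N) \<in> Syl p (G Mod N)"
      "pi_group {p} (G\<lparr>carrier := P\<rparr> Mod N)"
      using ex_Sylow_Mod[OF finite_carrier, of p] by blast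
    \<comment> \<open>The only prime that can divide |P/N| is p, which lies outside \<pi>.\<close>
    have "pi_group (prime_complement \<pi>) (G\<lparr>carrier := P\<rparr> Mod N)"
      using P(4) p by (auto simp: pi_group_def pi_number_def prime_complement_def)
    then have "extends_to G N \<theta> P" using \<theta>' P by (auto simp: extends_to_def)
    then show "\<exists>P. subgroup P G \<and> N \<subseteq> P \<and> carrier (G\<lparr>carrier := P\<rparr> Mod N) \<in> Syl p (G Mod N) \<and>
        extends_to G N \<theta> P" using P by blast
  qed
  \<comment> \<open>A prime divisor of the order outside \<pi> would admit an extension to a Sylow
    preimage, and then it could not divide the order.\<close>
  have ba: ?a if b: ?b
    unfolding pi_number_def using ord_pos b extends_to_Sylow_imp_not_dvd_ord by blast
  show ?thesis using ac cb ba by blast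
qed

end
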